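(* Let $d\in\{2,3\}$, let $\Omega\subset\mathbb{R}^d$ be an open bounded domain, let $\nu>0$, let $f\in V^*$, and let $u\in V$ be a solution of the steady Navier–Stokes equations in the weak form $$a(u,v)+b(u,u,v)=\langle f,v\rangle_*\quad\forall v\in V.$$ Let $M>0$ and $M_1>0$ be constants (depending on $\Omega$) such that for all $u,w,v\in X$, $$b(u,w,v)\le M\|\nabla u\|\|\nabla w\|\|\nabla v\|,\qquad b(u,w,v)\le M_1\|u\|^{1/2}\|\nabla u\|^{1/2}\|\nabla w\|\|\nabla v\|,$$ and set $\alpha=M\nu^{-2}\|f\|_*$. Let $H>0$ and let $I_H$ be a linear operator satisfying, for constants $C_I,C>0$, $$\|I_Hv-v\|\le C_IH\|\nabla v\|,\qquad \|I_Hv\|\le C\|v\|\quad\forall v\in X.$$ For $\mu>0$ consider the CDA-NSE problem: find $w\in V$ such that $$a(w,v)+b(w,w,v)+\mu(I_Hw-I_Hu,I_Hv)=\langle f,v\rangle_*\quad\forall v\in V.$$ Then: (i) If $\alpha<1$, then for every $H>0$ and every $\mu>0$, the CDA-NSE problem has a unique solution $w$, and $w=u$. (ii) If $\alpha\ge 1$ and $$H\le \frac{2M^2}{3\sqrt{3}\,C_IM_1^2\alpha^2}\quad\text{and}\quad \mu\ge\frac{\nu}{4C_I^2H^2},$$ then the CDA-NSE problem has a unique solution $w$, and $w=u$ (i.e. it is exactly the solution of the Navier–Stokes problem corresponding to the observed data $I_Hu$).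
   Context: Notation: $(\cdot,\cdot)$ and $\|\cdot\|$ are the $L^2(\Omega)$ inner product and norm. $X=\{v\in H^1(\Omega)^d: v=0 \text{ on }\partial\Omega\}$, $V=\{v\in X:\nabla\cdot v=0\}$, and $V^*$ is the dual of $V$ with pairing $\langle\cdot,\cdot\rangle_*$ and norm $\|z\|_*=\sup_{v\in V, v\neq 0}\langle z,v\rangle_*/\|\nabla v\|$. The forms are $a(u,v)=(\nu\nabla u,\nabla v)$ and $b(u,w,v)=((u\cdot\nabla)w,v)$ for $u,w,v\in X$. *)

theory Defs
  imports "HOL-Analysis.Analysis"
begin

(* Functions on R^d are modelled as functions real^'d => _, the domain Omega as a set.
   Elements of L^2 / H^1 are representatives; equality of elements is a.e. equality on Omega. *)

definition ae_eq_on :: "(real^'d::finite) set \<Rightarrow> (real^'d \<Rightarrow> 'b) \<Rightarrow> (real^'d \<Rightarrow> 'b) \<Rightarrow> bool" where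
  "ae_eq_on \<Omega> u w \<longleftrightarrow> (AE x in lebesgue. x \<in> \<Omega> \<longrightarrow> u x = w x)"

definition L2 :: "(real^'d::finite) set \<Rightarrow> (real^'d \<Rightarrow> 'b::euclidean_space) \<Rightarrow> bool" where
  "L2 \<Omega> u \<longleftrightarrow> set_borel_measurable lebesgue \<Omega> u \<and>
     set_integrable lebesgue \<Omega> (\<lambda>x. (norm (u x))\<^sup>2)"

definition l2inner :: "(real^'d::finite) set \<Rightarrow> (real^'d \<Rightarrow> 'b::euclidean_space) \<Rightarrow> (real^'d \<Rightarrow> 'b) \<Rightarrow> real" where
  "l2inner \<Omega> u v = (LINT x:\<Omega>|lebesgue. u x \<bullet> v x)"

definition l2norm :: "(real^'d::finite) set \<Rightarrow> (real^'d \<Rightarrow> 'b::euclidean_space) \<Rightarrow> real" where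
  "l2norm \<Omega> u = sqrt (LINT x:\<Omega>|lebesgue. (norm (u x))\<^sup>2)"

definition partial :: "'d \<Rightarrow> (real^'d::finite \<Rightarrow> real) \<Rightarrow> real^'d \<Rightarrow> real" where
  "partial j \<phi> = (\<lambda>x. frechet_derivative \<phi> (at x) (axis j 1))"

fun iter_partial :: "'d list \<Rightarrow> (real^'d::finite \<Rightarrow> real) \<Rightarrow> real^'d \<Rightarrow> real" where
  "iter_partial [] \<phi> = \<phi>"
| "iter_partial (j # js) \<phi> = partial j (iter_partial js \<phi>)"

definition smooth :: "(real^'d::finite \<Rightarrow> real) \<Rightarrow> bool" where
  "smooth \<phi> \<longleftrightarrow> (\<forall>js x. iter_partial js \<phi> differentiable (at x))"

definition test_fun :: "(real^'d::finite) set \<Rightarrow> (real^'d \<Rightarrow> real) \<Rightarrow> bool" where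
  "test_fun \<Omega> \<phi> \<longleftrightarrow> smooth \<phi> \<and> compact (closure {x. \<phi> x \<noteq> 0}) \<and>
     closure {x. \<phi> x \<noteq> 0} \<subseteq> \<Omega>"

definition test_field :: "(real^'d::finite) set \<Rightarrow> (real^'d \<Rightarrow> real^'d) \<Rightarrow> bool" where
  "test_field \<Omega> \<phi> \<longleftrightarrow> (\<forall>i. test_fun \<Omega> (\<lambda>x. \<phi> x $ i))"

definition is_weak_grad :: "(real^'d::finite) set \<Rightarrow> (real^'d \<Rightarrow> real^'d) \<Rightarrow> (real^'d \<Rightarrow> real^'d^'d) \<Rightarrow> bool" where
  "is_weak_grad \<Omega> u G \<longleftrightarrow> (\<forall>\<phi> i j. test_fun \<Omega> \<phi> \<longrightarrow>
      (LINT x:\<Omega>|lebesgue. u x $ i * partial j \<phi> x) = - (LINT x:\<Omega>|lebesgue. G x $ i $ j * \<phi> x))"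

definition H1 :: "(real^'d::finite) set \<Rightarrow> (real^'d \<Rightarrow> real^'d) \<Rightarrow> bool" where
  "H1 \<Omega> u \<longleftrightarrow> L2 \<Omega> u \<and> (\<exists>G. L2 \<Omega> G \<and> is_weak_grad \<Omega> u G)"

definition grad :: "(real^'d::finite) set \<Rightarrow> (real^'d \<Rightarrow> real^'d) \<Rightarrow> real^'d \<Rightarrow> real^'d^'d" where
  "grad \<Omega> u = (SOME G. L2 \<Omega> G \<and> is_weak_grad \<Omega> u G)"

(* ||grad u|| (L^2 norm with Frobenius norm pointwise) *)
definition gnorm :: "(real^'d::finite) set \<Rightarrow> (real^'d \<Rightarrow> real^'d) \<Rightarrow> real" where
  "gnorm \<Omega> u = l2norm \<Omega> (grad \<Omega> u)"

definition Xsp :: "(real^'d::finite) set \<Rightarrow> (real^'d \<Rightarrow> real^'d) set" where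
  "Xsp \<Omega> = {u. H1 \<Omega> u \<and> (\<exists>\<phi>. (\<forall>n. test_field \<Omega> (\<phi> n)) \<and>
      (\<lambda>n. l2norm \<Omega> (\<lambda>x. \<phi> n x - u x) + l2norm \<Omega> (\<lambda>x. grad \<Omega> (\<phi> n) x - grad \<Omega> u x))
        \<longlonglongrightarrow> 0)}"

(* V = divergence free elements of X; weak divergence = trace of weak gradient *)
definition Vsp :: "(real^'d::finite) set \<Rightarrow> (real^'d \<Rightarrow> real^'d) set" where
  "Vsp \<Omega> = {u \<in> Xsp \<Omega>. AE x in lebesgue. x \<in> \<Omega> \<longrightarrow> trace (grad \<Omega> u x) = 0}"

definition aform :: "(real^'d::finite) set \<Rightarrow> real \<Rightarrow> (real^'d \<Rightarrow> real^'d) \<Rightarrow> (real^'d \<Rightarrow> real^'d) \<Rightarrow> real" where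
  "aform \<Omega> \<nu> u v = \<nu> * l2inner \<Omega> (grad \<Omega> u) (grad \<Omega> v)"

(* b(u,w,v) = ((u . grad) w, v) *)
definition bform :: "(real^'d::finite) set \<Rightarrow> (real^'d \<Rightarrow> real^'d) \<Rightarrow> (real^'d \<Rightarrow> real^'d) \<Rightarrow> (real^'d \<Rightarrow> real^'d) \<Rightarrow> real" where
  "bform \<Omega> u w v = (LINT x:\<Omega>|lebesgue. (grad \<Omega> w x *v u x) \<bullet> v x)"

definition dual_V :: "(real^'d::finite) set \<Rightarrow> ((real^'d \<Rightarrow> real^'d) \<Rightarrow> real) \<Rightarrow> bool" where
  "dual_V \<Omega> f \<longleftrightarrow>
     (\<forall>u\<in>Vsp \<Omega>. \<forall>v\<in>Vsp \<Omega>. \<forall>a b. f (\<lambda>x. a *\<^sub>R u x + b *\<^sub>R v x) = a * f u + b * f v) \<and>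
     (\<exists>K. \<forall>v\<in>Vsp \<Omega>. \<bar>f v\<bar> \<le> K * gnorm \<Omega> v)"

definition dual_norm :: "(real^'d::finite) set \<Rightarrow> ((real^'d \<Rightarrow> real^'d) \<Rightarrow> real) \<Rightarrow> real" where
  "dual_norm \<Omega> f = (SUP v \<in> {v \<in> Vsp \<Omega>. v \<noteq> (\<lambda>_. 0)}. f v / gnorm \<Omega> v)"

definition NSE_sol :: "(real^'d::finite) set \<Rightarrow> real \<Rightarrow> ((real^'d \<Rightarrow> real^'d) \<Rightarrow> real) \<Rightarrow> (real^'d \<Rightarrow> real^'d) \<Rightarrow> bool" where
  "NSE_sol \<Omega> \<nu> f u \<longleftrightarrow> u \<in> Vsp \<Omega> \<and>
     (\<forall>v\<in>Vsp \<Omega>. aform \<Omega> \<nu> u v + bform \<Omega> u u v = f v)"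

definition CDA_sol :: "(real^'d::finite) set \<Rightarrow> real \<Rightarrow> ((real^'d \<Rightarrow> real^'d) \<Rightarrow> real) \<Rightarrow> real
     \<Rightarrow> ((real^'d \<Rightarrow> real^'d) \<Rightarrow> (real^'d \<Rightarrow> real^'d)) \<Rightarrow> (real^'d \<Rightarrow> real^'d) \<Rightarrow> (real^'d \<Rightarrow> real^'d) \<Rightarrow> bool" where
  "CDA_sol \<Omega> \<nu> f \<mu> IH u w \<longleftrightarrow> w \<in> Vsp \<Omega> \<and>
     (\<forall>v\<in>Vsp \<Omega>. aform \<Omega> \<nu> w v + bform \<Omega> w w v
        + \<mu> * l2inner \<Omega> (\<lambda>x. IH w x - IH u x) (IH v) = f v)"

end

theory Submission
  imports Defs
begin

text \<open>
  Write \<open>e = w - u\<close> for the difference of a CDA solution and the given Navier-Stokes solution. Testing the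
  difference of the two equations with \<open>e\<close> and using \<open>b(w,e,e) = 0\<close> gives
  \<open>\<nu> \<parallel>\<nabla>e\<parallel>\<^sup>2 + \<mu> \<parallel>I\<^sub>H e\<parallel>\<^sup>2 = - b(e,u,e)\<close>, while \<open>\<nu> \<parallel>\<nabla>u\<parallel> \<le> \<parallel>f\<parallel>\<^sub>*\<close>.
  If \<open>\<alpha> < 1\<close>, the bound with \<open>M\<close> lets the viscous term absorb the right-hand side. Otherwise the bound with
  \<open>M\<^sub>1\<close> and \<open>\<parallel>e\<parallel> \<le> C\<^sub>I H \<parallel>\<nabla>e\<parallel> + \<parallel>I\<^sub>H e\<parallel>\<close> let viscosity and nudging together absorb it, by Young's inequality.
  In both cases \<open>\<nabla>e = 0\<close> and \<open>I\<^sub>H e = 0\<close>, hence \<open>e = 0\<close> by the interpolation estimate, without the Poincare inequality.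

  Two facts make the formal manipulations legitimate. Weak gradients are unique almost everywhere, so \<^const>\<open>grad\<close>
  is linear up to null sets. And elements of \<open>X\<close> lie in \<open>L\<^sup>4\<close> when \<open>d \<le> 3\<close>, so the integrand of \<open>b\<close>
  is integrable; otherwise its integral would be the junk value 0 and \<open>b\<close> would not be trilinear.
\<close>

section \<open>Smooth functions and bump functions\<close>


text \<open>Existence is immediate: for w = u the nudging term vanishes, so both parts amount to
  uniqueness up to null sets.

  The obstacle is that \<open>grad\<close> is an arbitrary choice among weak gradients. Every
  identity for it has to come from uniqueness, and uniqueness needs a supply of functions that are
  \<open>smooth\<close> in the sense of iterated partial derivatives; hence the explicit bumps built
  from exp(-1/t).

  Elements of X are known only as H1 limits of test fields. The L4 bound is therefore proved for
  test functions, by the fundamental theorem of calculus along coordinate lines as in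
  Ladyzhenskaya's inequality, and reaches X by Fatou's lemma. The cancellation b(w,v,v) = 0 is
  proved for test fields as well and reaches X by the bound with M.

  In the case \<alpha> \<ge> 1 the threshold on \<mu> is the value at which the interpolation error
  costs a quarter of the viscous term. The bound on H enters through 3 sqrt 3 \<ge> 4, which makes
  C_I H (M_1 |grad u|)^2 at most \<nu>^2 / 2.\<close>

lemma partial_eqI: "(f has_derivative D) (at x) \<Longrightarrow> partial j f x = D (axis j 1)"
  unfolding partial_def using frechet_derivative_at by fastforce

lemma partial_works:
  "f differentiable (at x) \<Longrightarrow> (f has_derivative frechet_derivative f (at x)) (at x)"
  by (simp add: frechet_derivative_works)

lemma partial_add:
  assumes "\<And>x. f differentiable (at x)" "\<And>x. g differentiable (at x)"
  shows "partial j (\<lambda>x. f x + g x) = (\<lambda>x. partial j f x + partial j g x)"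
proof
  fix x show "partial j (\<lambda>x. f x + g x) x = partial j f x + partial j g x"
    by (subst partial_eqI[OF has_derivative_add[OF partial_works[OF assms(1)] partial_works[OF assms(2)]]])
      (simp add: partial_def)
qed

lemma partial_mult:
  assumes "\<And>x. f differentiable (at x)" "\<And>x. g differentiable (at x)"
  shows "partial j (\<lambda>x. f x * g x) = (\<lambda>x. partial j f x * g x + f x * partial j g x)"
proof
  fix x show "partial j (\<lambda>x. f x * g x) x = partial j f x * g x + f x * partial j g x"
    by (subst partial_eqI[OF has_derivative_mult[OF partial_works[OF assms(1)] partial_works[OF assms(2)]]])
      (simp add: partial_def)
qed

lemma partial_const: "partial j (\<lambda>x. c) = (\<lambda>x. 0)"
  by (simp add: partial_def)

text \<open>A recursive form of \<^const>\<open>smooth\<close> that peels off the innermost derivative, so that closure under products follows by induction on the order.\<close>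

fun Ck :: "nat \<Rightarrow> (real^'d::finite \<Rightarrow> real) \<Rightarrow> bool" where
  "Ck 0 \<phi> = (\<forall>x. \<phi> differentiable (at x))"
| "Ck (Suc n) \<phi> = ((\<forall>x. \<phi> differentiable (at x)) \<and> (\<forall>j. Ck n (partial j \<phi>)))"

lemma Ck_differentiable: "Ck n \<phi> \<Longrightarrow> \<phi> differentiable (at x)"
  by (cases n) auto

lemma Ck_Suc_imp: "Ck (Suc n) \<phi> \<Longrightarrow> Ck n \<phi>"
  by (induction n arbitrary: \<phi>) auto

lemma iter_partial_snoc: "iter_partial (js @ [j]) \<phi> = iter_partial js (partial j \<phi>)"
  by (induction js) auto

lemma Ck_iff:
  "Ck n \<phi> \<longleftrightarrow> (\<forall>js x. length js \<le> n \<longrightarrow> iter_partial js \<phi> differentiable (at x))"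
proof (induction n arbitrary: \<phi>)
  case 0 then show ?case by auto
next
  case (Suc n)
  show ?case
  proof
    assume C: "Ck (Suc n) \<phi>"
    show "\<forall>js x. length js \<le> Suc n \<longrightarrow> iter_partial js \<phi> differentiable (at x)"
    proof (intro allI impI)
      fix js :: "'a list" and x assume l: "length js \<le> Suc n"
      show "iter_partial js \<phi> differentiable (at x)"
      \<comment> \<open>\<open>Ck\<close> strips the innermost derivative, and in
        \<open>iter_partial\<close> that one is the last entry of the list.\<close>
      proof (cases js rule: rev_cases)
        case Nil then show ?thesis using C by auto
      next
        case (snoc ys y)
        have "Ck n (partial y \<phi>)" using C by simp
        then show ?thesis using l Suc.IH[of "partial y \<phi>"] by (simp add: snoc iter_partial_snoc)
      qed
    qed
  next
    assume A: "\<forall>js x. length js \<le> Suc n \<longrightarrow> iter_partial js \<phi> differentiable (at x)"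
    have "\<phi> differentiable (at x)" for x using A[rule_format, of "[]" x] by simp
    moreover have "Ck n (partial j \<phi>)" for j
      unfolding Suc.IH
    proof (intro allI impI)
      fix js :: "'a list" and x assume "length js \<le> n"
      then show "iter_partial js (partial j \<phi>) differentiable at x"
        using A[rule_format, of "js @ [j]" x] by (simp add: iter_partial_snoc)
    qed
    ultimately show "Ck (Suc n) \<phi>" by simp
  qed
qed

lemma smooth_iff_Ck: "smooth \<phi> \<longleftrightarrow> (\<forall>n. Ck n \<phi>)"
  unfolding smooth_def Ck_iff by auto

lemma Ck_const: "Ck n (\<lambda>x. c)"
  by (induction n arbitrary: c) (auto simp: partial_const)

lemma Ck_add: "Ck n f \<Longrightarrow> Ck n g \<Longrightarrow> Ck n (\<lambda>x. f x + g x)"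
proof (induction n arbitrary: f g)
  case 0 then show ?case by (auto intro: differentiable_add)
next
  case (Suc n) then show ?case by (auto simp: partial_add)
qed

lemma Ck_mult: "Ck n f \<Longrightarrow> Ck n g \<Longrightarrow> Ck n (\<lambda>x. f x * g x)"
proof (induction n arbitrary: f g)
  case 0 then show ?case by auto
next
  case (Suc n)
  \<comment> \<open>Each summand of the product rule keeps one factor undifferentiated, which has to
    be weakened to order \<open>n\<close> before the induction hypothesis applies.\<close>
  have "Ck n f" "Ck n g" using Suc.prems Ck_Suc_imp by blast+
  then show ?case using Suc.prems Suc.IH by (auto simp: partial_mult intro!: Ck_add)
qed

section \<open>Closure properties of smooth functions\<close>

lemma smooth_differentiable: "smooth \<phi> \<Longrightarrow> \<phi> differentiable (at x)"
  unfolding smooth_iff_Ck using Ck_differentiable by blast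

lemma smooth_partial: "smooth \<phi> \<Longrightarrow> smooth (partial j \<phi>)"
  unfolding smooth_iff_Ck using Ck.simps(2) by blast

lemma smooth_continuous_on: "smooth \<phi> \<Longrightarrow> continuous_on A \<phi>"
  by (meson continuous_at_imp_continuous_on differentiable_imp_continuous_within smooth_differentiable)

lemma smooth_add: "smooth f \<Longrightarrow> smooth g \<Longrightarrow> smooth (\<lambda>x. f x + g x)"
  by (simp add: smooth_iff_Ck Ck_add)

lemma smooth_mult: "smooth f \<Longrightarrow> smooth g \<Longrightarrow> smooth (\<lambda>x. f x * g x)"
  by (simp add: smooth_iff_Ck Ck_mult)

lemma smooth_const: "smooth (\<lambda>x. c)"
  by (simp add: smooth_iff_Ck Ck_const)

lemma smooth_prod: "(\<And>i. i \<in> I \<Longrightarrow> smooth (f i)) \<Longrightarrow> smooth (\<lambda>x. \<Prod>i\<in>I. f i x)"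
  by (induction I rule: infinite_finite_induct) (auto intro: smooth_mult smooth_const)

text \<open>The derivative of \<open>t\<^sup>-\<^sup>n exp(-1/t)\<close> is a combination of the functions with exponents \<open>n+2\<close> and \<open>n+1\<close>, so the whole family is smooth by a simultaneous induction.\<close>

definition flat_exp :: "nat \<Rightarrow> real \<Rightarrow> real" where
  "flat_exp n t = (if t > 0 then (1/t)^n * exp (- (1/t)) else 0)"

text \<open>In the variable s = 1/t this is the decay of s^n exp(-s) at infinity. All flatness of
  the family at the origin comes from here.\<close>

lemma flat_exp_tendsto_0: "(flat_exp n \<longlongrightarrow> 0) (at 0)"
proof -
  have "((\<lambda>t. (1/t)^n / exp (1/t)) \<longlongrightarrow> 0) (at_right (0::real))"
    using filterlim_compose[OF tendsto_power_div_exp_0 filterlim_inverse_at_top_right]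
    by (simp add: inverse_eq_divide)
  then have "(flat_exp n \<longlongrightarrow> 0) (at_right 0)"
    by (rule Lim_transform_eventually)
      (auto simp: flat_exp_def exp_minus field_simps eventually_at_filter)
  moreover have "(flat_exp n \<longlongrightarrow> 0) (at_left 0)"
    by (rule Lim_transform_eventually[OF tendsto_const]) (auto simp: flat_exp_def eventually_at_filter)
  ultimately show ?thesis by (simp add: filterlim_at_split)
qed

lemma flat_exp_has_derivative:
  "(flat_exp n has_real_derivative flat_exp (n+2) t - real n * flat_exp (n+1) t) (at t)"
proof -
  consider "t > 0" | "t < 0" | "t = 0" by linarith
  then show ?thesis
  proof cases
    case 1
    have "((\<lambda>t. (1/t)^n * exp (- (1/t))) has_real_derivative flat_exp (n+2) t - real n * flat_exp (n+1) t) (at t)"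
    proof -
      have E: "t * t ^ (k - Suc 0) = t ^ k" if "k > 0" for k using that by (cases k) auto
      show ?thesis
        using 1 by (cases n) (auto intro!: derivative_eq_intros simp: flat_exp_def field_simps power2_eq_square, metis E neq0_conv)
    qed
    then show ?thesis
      by (rule has_field_derivative_transform_within_open[where S="{0<..}"]) (use 1 in \<open>auto simp: flat_exp_def\<close>)
  next
    case 2
    have "((\<lambda>t. 0) has_real_derivative flat_exp (n+2) t - real n * flat_exp (n+1) t) (at t)"
      using 2 by (auto simp: flat_exp_def)
    then show ?thesis
      by (rule has_field_derivative_transform_within_open[where S="{..<0}"]) (use 2 in \<open>auto simp: flat_exp_def\<close>)
  next
    case 3
    \<comment> \<open>At the origin the difference quotient of \<open>flat_exp n\<close> is
      \<open>flat_exp (Suc n)\<close> itself.\<close>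
    have "((\<lambda>h. flat_exp n h / h) \<longlongrightarrow> 0) (at 0)"
      by (rule Lim_transform_eventually[OF flat_exp_tendsto_0[of "Suc n"]])
        (auto simp: flat_exp_def eventually_at_filter)
    then show ?thesis unfolding 3 by (simp add: DERIV_def flat_exp_def)
  qed
qed

lemma flat_exp_nonneg: "0 \<le> flat_exp n t" by (simp add: flat_exp_def)

lemma flat_exp_0_le_1: "flat_exp 0 t \<le> 1" by (simp add: flat_exp_def)

text \<open>An affine function of one coordinate is the argument of every factor of
  \<open>box_bump\<close>. The induction generalises \<open>n\<close> because differentiation raises
  it.\<close>

lemma Ck_flat_exp_affine: "Ck m (\<lambda>x::real^'d. flat_exp n (c * x $ k + d))"
proof -
  have D: "((\<lambda>x::real^'d. flat_exp n (c * x $ k + d)) has_derivative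
      (\<lambda>h. (flat_exp (n+2) (c * x $ k + d) - real n * flat_exp (n+1) (c * x $ k + d)) * (c * h $ k))) (at x)" for n x
  proof -
    have "((\<lambda>x::real^'d. c * x $ k + d) has_derivative (\<lambda>h. c * h $ k)) (at x)"
      by (auto intro!: derivative_eq_intros bounded_linear.has_derivative[OF bounded_linear_vec_nth])
    from has_derivative_compose[OF this flat_exp_has_derivative[unfolded has_field_derivative_def]]
    show ?thesis by simp
  qed
  have P: "partial j (\<lambda>x::real^'d. flat_exp n (c * x $ k + d)) =
     (\<lambda>x. (flat_exp (n+2) (c * x $ k + d) + (- real n) * flat_exp (n+1) (c * x $ k + d)) * (c * axis j 1 $ k))" for j n
    by (rule ext, subst partial_eqI[OF D]) (simp add: axis_def)
  show ?thesis
  proof (induction m arbitrary: n)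
    case 0 show ?case using D by (auto simp: differentiable_def)
  next
    case (Suc m)
    show ?case unfolding Ck.simps(2) P
      using D by (intro conjI allI Ck_add Ck_mult Ck_const Suc.IH) (auto simp: differentiable_def)
  qed
qed

lemma smooth_flat_exp_affine: "smooth (\<lambda>x::real^'d. flat_exp n (c * x $ k + d))"
  by (simp add: smooth_iff_Ck Ck_flat_exp_affine)

text \<open>Scaling the argument by \<open>n\<close> amounts to taking the \<open>n\<close>-th root of \<open>exp(-1/s)\<close>: this turns bump functions into indicators.\<close>

lemma LIMSEQ_flat_exp_scaled:
  "(\<lambda>n. flat_exp 0 (real n * s)) \<longlonglongrightarrow> (if s > 0 then 1 else 0)"
proof (cases "s > 0")
  case True
  have "(\<lambda>n. exp (- ((1/s) * (1 / real n)))) \<longlonglongrightarrow> exp (- ((1/s) * 0))"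
    by (intro tendsto_intros lim_1_over_n)
  then have "(\<lambda>n. flat_exp 0 (real n * s)) \<longlonglongrightarrow> 1"
    apply simp
    by (rule Lim_transform_eventually[OF _ eventually_sequentiallyI[of 1]])
      (use True in \<open>auto simp: flat_exp_def field_simps\<close>)
  then show ?thesis using True by simp
next
  case False
  then have "real n * s \<le> 0" for n by (simp add: mult_nonneg_nonpos)
  then have "flat_exp 0 (real n * s) = 0" for n by (simp add: flat_exp_def not_less)
  then show ?thesis using False by simp
qed

text \<open>Two factors per coordinate, one for each face of the box. As \<open>n\<close> grows,
  each tends to 1 on the inner side of its face, and it is 0 on the outer side.\<close>

definition box_bump :: "real^'d \<Rightarrow> real^'d \<Rightarrow> nat \<Rightarrow> real^'d::finite \<Rightarrow> real" where
  "box_bump a b n x = (\<Prod>k\<in>UNIV. flat_exp 0 (real n * (x $ k - a $ k)) * flat_exp 0 (real n * (b $ k - x $ k)))"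

lemma smooth_box_bump: "smooth (box_bump a b n)"
proof -
  have "box_bump a b n = (\<lambda>x. \<Prod>k\<in>UNIV. flat_exp 0 (real n * x $ k + (- real n * a $ k)) *
           flat_exp 0 ((- real n) * x $ k + real n * b $ k))"
    by (rule ext) (simp add: box_bump_def algebra_simps)
  then show ?thesis by (simp only:) (intro smooth_prod smooth_mult smooth_flat_exp_affine)
qed

lemma box_bump_eq_0: "x \<notin> box a b \<Longrightarrow> box_bump a b n x = 0"
proof -
  assume "x \<notin> box a b"
  then obtain k where "x $ k - a $ k \<le> 0 \<or> b $ k - x $ k \<le> 0" by (auto simp: mem_box_cart not_less)
  then have "flat_exp 0 (real n * (x $ k - a $ k)) * flat_exp 0 (real n * (b $ k - x $ k)) = 0"
    by (auto simp: flat_exp_def zero_less_mult_iff)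
  then show ?thesis unfolding box_bump_def by (intro prod_zero) auto
qed

lemma abs_box_bump_le_1: "\<bar>box_bump a b n x\<bar> \<le> 1"
  unfolding box_bump_def abs_prod
  by (intro prod_le_1) (auto simp: abs_mult flat_exp_nonneg intro!: mult_le_one flat_exp_0_le_1)

lemma LIMSEQ_box_bump: "(\<lambda>n. box_bump a b n x) \<longlonglongrightarrow> indicator (box a b) x"
proof -
  have "(\<lambda>n. box_bump a b n x) \<longlonglongrightarrow> (\<Prod>k\<in>UNIV. (if x $ k - a $ k > 0 then 1 else 0) * (if b $ k - x $ k > 0 then 1 else 0))"
    unfolding box_bump_def by (intro tendsto_prod tendsto_mult LIMSEQ_flat_exp_scaled)
  moreover have "(\<Prod>k\<in>UNIV. (if x $ k - a $ k > 0 then 1 else 0) * (if b $ k - x $ k > 0 then 1 else 0)) = (indicator (box a b) x :: real)"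
  proof (cases "x \<in> box a b")
    case True then show ?thesis by (auto simp: mem_box_cart)
  next
    case False then show ?thesis by (auto simp: mem_box_cart intro!: prod_zero split: if_splits)
  qed
  ultimately show ?thesis by simp
qed

lemma test_fun_box_bump:
  assumes "cbox a b \<subseteq> \<Omega>" shows "test_fun \<Omega> (box_bump a b n)"
proof -
  have "closure {x. box_bump a b n x \<noteq> 0} \<subseteq> cbox a b"
    using box_bump_eq_0[of _ a b n] box_subset_cbox[of a b] by (intro closure_minimal closed_cbox) blast
  moreover have "compact (closure {x. box_bump a b n x \<noteq> 0})"
    using calculation by (meson bounded_cbox bounded_subset closed_closure compact_eq_bounded_closed)
  ultimately show ?thesis unfolding test_fun_def using assms smooth_box_bump by auto
qed

section \<open>Test functions and the fundamental lemma\<close>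


lemma line_has_derivative:
  assumes "\<phi> differentiable (at (x + t *\<^sub>R axis j 1))"
  shows "((\<lambda>t. \<phi> (x + t *\<^sub>R axis j 1)) has_real_derivative partial j \<phi> (x + t *\<^sub>R axis j 1)) (at t)"
proof -
  let ?D = "frechet_derivative \<phi> (at (x + t *\<^sub>R axis j 1))"
  have D: "(\<phi> has_derivative ?D) (at (x + t *\<^sub>R axis j 1))" using assms by (rule partial_works)
  have "((\<lambda>t. x + t *\<^sub>R axis j (1::real)) has_derivative (\<lambda>h. h *\<^sub>R axis j 1)) (at t)"
    by (auto intro!: derivative_eq_intros)
  from has_derivative_compose[OF this D]
  have "((\<lambda>t. \<phi> (x + t *\<^sub>R axis j 1)) has_derivative (\<lambda>h. ?D (h *\<^sub>R axis j 1))) (at t)" .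
  moreover have "?D (h *\<^sub>R axis j 1) = h * ?D (axis j 1)" for h
    using linear_scale[OF has_derivative_linear[OF D]] by simp
  ultimately show ?thesis by (simp add: has_field_derivative_def partial_def mult.commute[of _ "?D (axis j 1)"])
qed

lemma test_fun_smooth: "test_fun \<Omega> \<phi> \<Longrightarrow> smooth \<phi>"
  by (simp add: test_fun_def)

lemma test_fun_differentiable: "test_fun \<Omega> \<phi> \<Longrightarrow> \<phi> differentiable (at x)"
  by (simp add: test_fun_smooth smooth_differentiable)

lemma test_fun_borel: "test_fun \<Omega> \<phi> \<Longrightarrow> \<phi> \<in> borel_measurable borel"
  by (intro borel_measurable_continuous_onI smooth_continuous_on test_fun_smooth)

lemma test_fun_zero_outside: "test_fun \<Omega> \<phi> \<Longrightarrow> x \<notin> \<Omega> \<Longrightarrow> \<phi> x = 0"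
  using closure_subset[of "{x. \<phi> x \<noteq> 0}"] by (auto simp: test_fun_def)

lemma smooth_subset_support_test_fun:
  assumes "test_fun \<Omega> \<phi>" "smooth \<psi>" "{x. \<psi> x \<noteq> 0} \<subseteq> closure {x. \<phi> x \<noteq> 0}"
  shows "test_fun \<Omega> \<psi>"
proof -
  have "closure {x. \<psi> x \<noteq> 0} \<subseteq> closure {x. \<phi> x \<noteq> 0}"
    using assms(3) by (intro closure_minimal) auto
  moreover then have "compact (closure {x. \<psi> x \<noteq> 0})"
    using assms(1) unfolding test_fun_def
    by (meson bounded_subset closed_closure compact_eq_bounded_closed)
  ultimately show ?thesis using assms unfolding test_fun_def by auto
qed

text \<open>Off the support the function is zero in a whole neighbourhood, so its derivative
  vanishes there and the support cannot grow.\<close>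

lemma test_fun_partial:
  assumes "test_fun \<Omega> \<phi>" shows "test_fun \<Omega> (partial j \<phi>)"
proof (rule smooth_subset_support_test_fun[OF assms smooth_partial[OF test_fun_smooth[OF assms]]], safe)
  fix x assume nz: "partial j \<phi> x \<noteq> 0"
  show "x \<in> closure {x. \<phi> x \<noteq> 0}"
  proof (rule ccontr)
    assume "x \<notin> closure {x. \<phi> x \<noteq> 0}"
    then have x: "x \<in> - closure {x. \<phi> x \<noteq> 0}" by simp
    have "((\<lambda>_. 0) has_derivative (\<lambda>_. 0)) (at x)" by simp
    then have "(\<phi> has_derivative (\<lambda>_. 0)) (at x)"
      by (rule has_derivative_transform_within_open[OF _ _ x])
        (use closure_subset[of "{x. \<phi> x \<noteq> 0}"] in auto)
    then show False using partial_eqI[of \<phi> _ x j] nz by auto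
  qed
qed

lemma test_fun_mult:
  assumes "test_fun \<Omega> f" "smooth g" shows "test_fun \<Omega> (\<lambda>x. f x * g x)"
  by (rule smooth_subset_support_test_fun[OF assms(1)])
    (use assms closure_subset[of "{x. f x \<noteq> 0}"] in \<open>auto intro: smooth_mult test_fun_smooth\<close>)

lemma test_fun_cmult: "test_fun \<Omega> f \<Longrightarrow> test_fun \<Omega> (\<lambda>x. c * f x)"
  using test_fun_mult[of \<Omega> f "\<lambda>_. c"] by (simp add: mult.commute smooth_const)

lemma test_fun_add:
  assumes "test_fun \<Omega> f" "test_fun \<Omega> g" shows "test_fun \<Omega> (\<lambda>x. f x + g x)"
proof -
  let ?S = "\<lambda>f::real^'a \<Rightarrow> real. closure {x. f x \<noteq> 0}"
  have sub: "closure {x. f x + g x \<noteq> 0} \<subseteq> ?S f \<union> ?S g"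
  proof (intro closure_minimal closed_Un closed_closure subsetI)
    fix x assume "x \<in> {x. f x + g x \<noteq> 0}"
    then consider "x \<in> {x. f x \<noteq> 0}" | "x \<in> {x. g x \<noteq> 0}" by fastforce
    then show "x \<in> ?S f \<union> ?S g" by cases (meson UnCI closure_subset subsetD)+
  qed
  moreover have "compact (closure {x. f x + g x \<noteq> 0})"
  proof -
    have "compact (?S f \<union> ?S g)" using assms by (intro compact_Un) (auto simp: test_fun_def)
    then show ?thesis
      using bounded_subset[OF compact_imp_bounded sub] by (simp add: compact_eq_bounded_closed)
  qed
  ultimately show ?thesis using assms unfolding test_fun_def by (blast intro: smooth_add)
qed

lemma test_fun_support_cball:
  assumes "test_fun \<Omega> \<phi>" obtains R where "R > 0" "\<And>x. \<phi> x \<noteq> 0 \<Longrightarrow> norm x \<le> R"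
proof -
  have "bounded (closure {x. \<phi> x \<noteq> 0})" using assms by (simp add: test_fun_def compact_imp_bounded)
  then obtain R where "R > 0" "\<forall>x\<in>closure {x. \<phi> x \<noteq> 0}. norm x \<le> R" unfolding bounded_pos by blast
  then show ?thesis using that[of R] closure_subset[of "{x. \<phi> x \<noteq> 0}"] by blast
qed

lemma test_fun_integrable:
  assumes "test_fun \<Omega> \<phi>" shows "integrable lborel \<phi>"
proof -
  let ?S = "closure {x. \<phi> x \<noteq> 0}"
  have "integrable lborel (\<lambda>x. indicator ?S x *\<^sub>R \<phi> x)"
    by (rule borel_integrable_compact)
      (use assms in \<open>auto simp: test_fun_def intro!: smooth_continuous_on\<close>)
  moreover have "(\<lambda>x. indicator ?S x *\<^sub>R \<phi> x) = \<phi>"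
    using closure_subset[of "{x. \<phi> x \<noteq> 0}"] by (intro ext) (auto simp: indicator_def)
  ultimately show ?thesis by simp
qed

lemma test_fun_bounded:
  assumes "test_fun \<Omega> \<phi>" obtains B where "B > 0" "\<And>x. \<bar>\<phi> x\<bar> \<le> B"
proof -
  let ?S = "closure {x. \<phi> x \<noteq> 0}"
  have "bounded (\<phi> ` ?S)"
    using assms by (intro compact_imp_bounded compact_continuous_image)
      (auto simp: test_fun_def intro!: smooth_continuous_on)
  then obtain B where B: "B > 0" "\<forall>x\<in>?S. \<bar>\<phi> x\<bar> \<le> B" unfolding bounded_pos by auto
  have "\<bar>\<phi> x\<bar> \<le> B" for x
    using B closure_subset[of "{x. \<phi> x \<noteq> 0}"] by (cases "\<phi> x = 0") auto
  with B(1) that show ?thesis by blast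
qed

section \<open>Translation invariance and integration by parts\<close>

lemma integral_lborel_translate:
  fixes f :: "'a::euclidean_space \<Rightarrow> real"
  assumes [measurable]: "f \<in> borel_measurable borel"
  shows "(LINT x|lborel. f (x + c)) = (LINT x|lborel. f x)"
    and "integrable lborel f \<Longrightarrow> integrable lborel (\<lambda>x. f (x + c))"
proof -
  have "(LINT x|lborel. f x) = (LINT x|distr lborel borel ((+) c). f x)" by (simp add: lborel_distr_plus)
  also have "\<dots> = (LINT x|lborel. f (x + c))" by (subst integral_distr) (auto simp: add.commute)
  finally show "(LINT x|lborel. f (x + c)) = (LINT x|lborel. f x)" by simp
  assume "integrable lborel f"
  then have "integrable (distr lborel borel ((+) c)) f" by (simp add: lborel_distr_plus)
  then show "integrable lborel (\<lambda>x. f (x + c))" by (subst (asm) integrable_distr_eq) (auto simp: add.commute)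
qed

text \<open>A difference quotient compares a function with its translate, so its integral is 0;
  dominated convergence passes this on to the derivative.\<close>

lemma integral_partial_test_fun:
  assumes \<phi>: "test_fun \<Omega> \<phi>" shows "(LINT x|lborel. partial j \<phi> x) = 0"
proof -
  define h where "h n = 1 / real (Suc n)" for n
  define D where "D n x = (\<phi> (x + h n *\<^sub>R axis j 1) - \<phi> x) / h n" for n x
  have h: "h n > 0" "h n \<le> 1" for n by (auto simp: h_def)
  have h0: "h \<longlonglongrightarrow> 0" unfolding h_def by (rule LIMSEQ_Suc[OF lim_1_over_n])
  obtain R where R: "R > 0" "\<And>x. \<phi> x \<noteq> 0 \<Longrightarrow> norm x \<le> R" using test_fun_support_cball[OF \<phi>] by blast
  obtain B where B: "B > 0" "\<And>x. \<bar>partial j \<phi> x\<bar> \<le> B" using test_fun_bounded[OF test_fun_partial[OF \<phi>]] by blast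
  have [measurable]: "\<phi> \<in> borel_measurable borel" "partial j \<phi> \<in> borel_measurable borel"
    using \<phi> test_fun_borel test_fun_partial by blast+
  note int = test_fun_integrable[OF \<phi>] integral_lborel_translate(2)[OF _ test_fun_integrable[OF \<phi>]]
  have line: "((\<lambda>t. \<phi> (x + t *\<^sub>R axis j 1)) has_real_derivative partial j \<phi> (x + t *\<^sub>R axis j 1)) (at t)" for x t
    by (rule line_has_derivative[OF test_fun_differentiable[OF \<phi>]])
  have "(\<lambda>n. LINT x|lborel. D n x) \<longlonglongrightarrow> (LINT x|lborel. partial j \<phi> x)"
  \<comment> \<open>The mean value theorem bounds the quotient by \<open>B\<close>. The steps
    \<open>h n\<close> are at most 1, so the quotient vanishes outside the ball of radius
    \<open>R + 1\<close>.\<close>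
  proof (rule integral_dominated_convergence[where w="\<lambda>x. B * indicator (cball 0 (R + 1)) x"])
    show "integrable lborel (\<lambda>x::real^'a. B * indicator (cball 0 (R + 1)) x)"
      by (intro integrable_mult_right) (simp_all add: integrable_indicator_iff emeasure_bounded_finite[OF bounded_cball, unfolded infinity_ennreal_def])
    show "AE x in lborel. (\<lambda>n. D n x) \<longlonglongrightarrow> partial j \<phi> x"
    proof (rule AE_I2)
      fix x
      have "((\<lambda>s. (\<phi> (x + (0 + s) *\<^sub>R axis j 1) - \<phi> (x + 0 *\<^sub>R axis j 1)) / s) \<longlongrightarrow> partial j \<phi> (x + 0 *\<^sub>R axis j 1)) (at 0)"
        using line[of x 0] unfolding DERIV_def .
      moreover have "filterlim h (at 0) sequentially"
        using h0 h(1) by (auto simp: filterlim_at less_imp_neq[symmetric])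
      ultimately show "(\<lambda>n. D n x) \<longlonglongrightarrow> partial j \<phi> x"
        unfolding D_def by (auto dest: filterlim_compose)
    qed
    show "AE x in lborel. norm (D n x) \<le> B * indicator (cball 0 (R + 1)) x" for n
    proof (rule AE_I2)
      fix x
      show "norm (D n x) \<le> B * indicator (cball 0 (R + 1)) x"
      proof (cases "norm x \<le> R + 1")
        case True
        obtain z where "\<phi> (x + h n *\<^sub>R axis j 1) - \<phi> (x + 0 *\<^sub>R axis j 1) = (h n - 0) * partial j \<phi> (x + z *\<^sub>R axis j 1)"
          using MVT2[OF h(1)[of n] line[of x]] by blast
        then have "D n x = partial j \<phi> (x + z *\<^sub>R axis j 1)" using h(1)[of n] by (simp add: D_def)
        then show ?thesis using B True by simp
      next
        case False
        have "norm x \<le> norm (x + h n *\<^sub>R axis j 1) + norm (h n *\<^sub>R axis j (1::real))"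
          by (metis add_diff_cancel_right' norm_triangle_ineq4)
        then have "norm (x + h n *\<^sub>R axis j 1) > R" using False h[of n] by simp
        then have "\<phi> (x + h n *\<^sub>R axis j 1) = 0" "\<phi> x = 0" using R False by fastforce+
        then show ?thesis using B by (simp add: D_def)
      qed
    qed
  qed (auto simp: D_def)
  moreover have "(LINT x|lborel. D n x) = 0" for n
    unfolding D_def by (simp add: int integral_lborel_translate(1))
  ultimately show ?thesis by (simp add: LIMSEQ_const_iff)
qed

lemma LINT_vanishing_outside:
  fixes f :: "real^'d \<Rightarrow> real"
  assumes "f \<in> borel_measurable borel" "\<And>x. x \<notin> \<Omega> \<Longrightarrow> f x = 0"
  shows "(LINT x:\<Omega>|lebesgue. f x) = (LINT x|lborel. f x)"
proof -
  have "(\<lambda>x. indicator \<Omega> x *\<^sub>R f x) = f" using assms(2) by (intro ext) (auto simp: indicator_def)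
  then show ?thesis unfolding set_lebesgue_integral_def using assms(1) by (simp add: integral_completion)
qed

text \<open>The product is again a test function, so its derivative has integral 0. This is what
  identifies the classical derivatives of a test field as a weak gradient.\<close>

lemma test_fun_integration_by_parts:
  assumes f: "test_fun \<Omega> f" and g: "test_fun \<Omega> g"
  shows "(LINT x:\<Omega>|lebesgue. f x * partial j g x) = - (LINT x:\<Omega>|lebesgue. partial j f x * g x)"
proof -
  have eq: "(LINT x:\<Omega>|lebesgue. f x * g x) = (LINT x|lborel. f x * g x)"
    if "test_fun \<Omega> f" "test_fun \<Omega> g" for f g :: "real^'a \<Rightarrow> real"
    using that test_fun_borel
    by (intro LINT_vanishing_outside borel_measurable_times) (auto simp: test_fun_zero_outside)
  have int: "integrable lborel (\<lambda>x. f x * g x)" if "test_fun \<Omega> f" "test_fun \<Omega> g" for f g :: "real^'a \<Rightarrow> real"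
    by (rule test_fun_integrable[OF test_fun_mult[OF that(1) test_fun_smooth[OF that(2)]]])
  have "(LINT x|lborel. partial j (\<lambda>x. f x * g x) x) = 0"
    by (rule integral_partial_test_fun[OF test_fun_mult[OF f test_fun_smooth[OF g]]])
  then have "(LINT x|lborel. partial j f x * g x + f x * partial j g x) = 0"
    by (subst (asm) partial_mult) (auto intro: test_fun_differentiable f g)
  then show ?thesis using f g by (simp add: eq int test_fun_partial)
qed

text \<open>Open boxes are stable under intersection and generate the Borel sets, so
  \<open>g\<close> integrates to 0 over every Borel set; the total integral serves the complements.
  Uniqueness of densities then gives the claim.\<close>

lemma AE_zero_if_integrals_box_zero:
  fixes g :: "'a::euclidean_space \<Rightarrow> real"
  assumes g: "integrable lborel g"
    and zero: "(LINT x|lborel. g x) = 0" "\<And>c d. (LINT x:box c d|lborel. g x) = 0"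
  shows "AE x in lborel. g x = 0"
proof -
  have [measurable]: "g \<in> borel_measurable borel" using g by auto
  have si: "set_integrable lborel A g" if "A \<in> sets borel" for A
    unfolding set_integrable_def using that g by (intro integrable_mult_indicator) auto
  have all: "(LINT x:A|lborel. g x) = 0" if "A \<in> sets borel" for A
  proof -
    let ?G = "range (\<lambda>(c, d::'a). box c d)"
    have ist: "Int_stable ?G"
    proof (rule Int_stableI)
      fix A B assume "A \<in> ?G" "B \<in> ?G"
      then obtain a b c d where "A = box a b" "B = box c d" by auto
      then have "A \<inter> B = box (\<Sum>i\<in>Basis. max (a \<bullet> i) (c \<bullet> i) *\<^sub>R i) (\<Sum>i\<in>Basis. min (b \<bullet> i) (d \<bullet> i) *\<^sub>R i)"
        by (simp add: box_Int_box)
      then show "A \<inter> B \<in> ?G" by auto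
    qed
    have gen: "sets borel = sigma_sets UNIV ?G"
      by (simp add: borel_eq_box sets_measure_of)
    have "A \<in> sigma_sets UNIV ?G" using that gen by simp
    then show ?thesis
    proof (induction rule: sigma_sets_induct_disjoint[OF ist subset_UNIV[of ?G, folded Pow_UNIV], consumes 1])
      case (1 A) then show ?case using zero(2) by auto
    next
      case 2 show ?case by (simp add: set_lebesgue_integral_def)
    next
      case (3 A)
      then have A: "A \<in> sets borel" using gen by simp
      have "(LINT x:(A \<union> (UNIV - A))|lborel. g x) = (LINT x:A|lborel. g x) + (LINT x:(UNIV - A)|lborel. g x)"
        using A by (intro set_integral_Un si) auto
      moreover have "A \<union> (UNIV - A) = UNIV" by auto
      ultimately show ?case using 3 zero(1) by (simp add: set_lebesgue_integral_def)
    next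
      case (4 A)
      then have A: "A i \<in> sets borel" for i using gen by auto
      have "(LINT x:(\<Union>i. A i)|lborel. g x) = (\<Sum>i. LINT x:A i|lborel. g x)"
        using 4 A by (intro lebesgue_integral_countable_add si) (auto simp: disjoint_family_on_def)
      then show ?case using 4 by simp
    qed
  qed
  show ?thesis
    by (rule density_unique_real[OF g, of "\<lambda>_. 0"]) (auto simp: all)
qed

text \<open>Bumps turn the hypothesis into vanishing integrals over open boxes whose closures lie in
  \<open>\<Omega>\<close>. Intersecting such a box with an arbitrary one gives another of the same
  kind, so \<open>g\<close> vanishes almost everywhere on it, and countably many of them suffice to
  cover an open set.\<close>

lemma fundamental_lemma:
  fixes g :: "real^'d \<Rightarrow> real"
  assumes "open \<Omega>" and g: "set_integrable lebesgue \<Omega> g"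
    and zero: "\<And>\<phi>. test_fun \<Omega> \<phi> \<Longrightarrow> (LINT x:\<Omega>|lebesgue. g x * \<phi> x) = 0"
  shows "AE x in lebesgue. x \<in> \<Omega> \<longrightarrow> g x = 0"
proof -
  define G where "G x = indicator \<Omega> x * g x" for x
  have G: "integrable lebesgue G" using g unfolding set_integrable_def G_def by simp
  have box0: "(LINT x|lebesgue. indicator (box a b) x * G x) = 0" if "cbox a b \<subseteq> \<Omega>" for a b
  proof -
    have [measurable]: "G \<in> borel_measurable lebesgue" using G by auto
    have [measurable]: "box_bump a b n \<in> borel_measurable lebesgue" for n
      by (intro measurable_completion) (use test_fun_borel[OF test_fun_box_bump[OF that]] in simp)
    have "(\<lambda>n. LINT x|lebesgue. box_bump a b n x * G x) \<longlonglongrightarrow> (LINT x|lebesgue. indicator (box a b) x * G x)"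
    proof (rule integral_dominated_convergence[where w="\<lambda>x. \<bar>G x\<bar>"])
      show "AE x in lebesgue. (\<lambda>n. box_bump a b n x * G x) \<longlonglongrightarrow> indicator (box a b) x * G x"
        by (intro AE_I2 tendsto_intros LIMSEQ_box_bump)
      show "AE x in lebesgue. norm (box_bump a b n x * G x) \<le> \<bar>G x\<bar>" for n
        by (intro AE_I2) (auto simp: abs_mult intro!: mult_left_le_one_le abs_box_bump_le_1)
    qed (use G in \<open>auto intro!: borel_measurable_times borel_measurable_indicator\<close>)
    moreover have "(LINT x|lebesgue. box_bump a b n x * G x) = 0" for n
      using zero[OF test_fun_box_bump[OF that, of n]]
      by (simp add: set_lebesgue_integral_def G_def mult_ac)
    ultimately show ?thesis by (simp add: LIMSEQ_const_iff)
  qed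
  \<comment> \<open>Boxes generate only the Borel sets, so a Borel representative replaces the
    Lebesgue measurable \<open>G\<close>.\<close>
  obtain G' where G': "G' \<in> borel_measurable lborel" "AE x in lebesgue. G x = G' x"
    using completion_ex_borel_measurable_real[of G lborel] G AE_completion by blast
  have G'l: "G' \<in> borel_measurable lebesgue" using G'(1) by (simp add: measurable_completion)
  have iG': "integrable lborel G'"
    using integrable_cong_AE_imp[OF G G'l] G'(1,2) by (simp add: integrable_completion eq_commute)
  have ae: "AE x in lborel. indicator (box a b) x * G' x = 0" if "cbox a b \<subseteq> \<Omega>" for a b
  proof (rule AE_zero_if_integrals_box_zero)
    show "integrable lborel (\<lambda>x. indicator (box a b) x * G' x)"
      using integrable_mult_indicator[OF _ iG', of "box a b"] by simp
    have *: "(LINT x|lborel. indicator (box a b) x * G' x) = 0" if "cbox a b \<subseteq> \<Omega>" for a b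
    proof -
      have "(LINT x|lborel. indicator (box a b) x * G' x) = (LINT x|lebesgue. indicator (box a b) x * G' x)"
        using G'(1) by (subst integral_completion) auto
      also have "\<dots> = (LINT x|lebesgue. indicator (box a b) x * G x)"
        using G'(2) G'l G by (intro integral_cong_AE borel_measurable_times borel_measurable_indicator) auto
      finally show ?thesis using box0[OF that] by simp
    qed
    show "(LINT x|lborel. indicator (box a b) x * G' x) = 0" by (rule *[OF that])
    fix c d
    \<comment> \<open>The intersection is taken for the closed boxes as well, because
      \<open>*\<close> asks for the closed box to lie in \<open>\<Omega>\<close>.\<close>
    obtain p q where pq: "box a b \<inter> box c d = box p q" "cbox a b \<inter> cbox c d = cbox p q"
      using that[OF box_Int_box Int_interval] .
    have "(LINT x:box c d|lborel. indicator (box a b) x * G' x) = (LINT x|lborel. indicator (box p q) x * G' x)"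
      unfolding set_lebesgue_integral_def pq(1)[symmetric] by (simp add: indicator_inter_arith mult_ac)
    then show "(LINT x:box c d|lborel. indicator (box a b) x * G' x) = 0" using *[of p q] pq(2) that by auto
  qed
  obtain \<D> where D: "countable \<D>" "\<D> \<subseteq> Pow \<Omega>" "\<And>X. X \<in> \<D> \<Longrightarrow> \<exists>a b. X = cbox a b" "\<Union>\<D> = \<Omega>"
    using open_countable_Union_open_cbox[OF \<open>open \<Omega>\<close>] by metis
  have "AE x in lebesgue. x \<in> X \<longrightarrow> g x = 0" if "X \<in> \<D>" for X
  proof -
    obtain a b where X: "X = cbox a b" "cbox a b \<subseteq> \<Omega>" using D(3)[OF \<open>X \<in> \<D>\<close>] D(2) \<open>X \<in> \<D>\<close> by auto
    \<comment> \<open>The cover consists of closed boxes, while the vanishing is known on open ones;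
      the difference is a null set.\<close>
    have "AE x in lborel. x \<notin> frontier (cbox a b)"
      using negligible_convex_frontier[OF convex_box(1), of a b]
      by (metis AE_completion_iff AE_not_in completion.complete2 negligible_iff_null_sets)
    then have "AE x in lebesgue. x \<notin> frontier (cbox a b)" by (rule AE_completion)
    moreover have "AE x in lebesgue. indicator (box a b) x * G' x = 0" using ae[OF X(2)] by (rule AE_completion)
    ultimately show ?thesis using G'(2)
    proof eventually_elim
      case (elim x)
      then show ?case using X by (auto simp: frontier_cbox G_def split: split_indicator_asm)
    qed
  qed
  then have "AE x in lebesgue. \<forall>X\<in>\<D>. x \<in> X \<longrightarrow> g x = 0" using D(1) by (subst AE_ball_countable) auto
  then show ?thesis by eventually_elim (use D(4) in auto)
qed

section \<open>Square integrable fields and weak gradients\<close>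


lemma set_integrable_iff_lebesgue_on:
  fixes f :: "real^'d \<Rightarrow> 'b::euclidean_space"
  assumes "\<Omega> \<in> sets lebesgue"
  shows "set_integrable lebesgue \<Omega> f \<longleftrightarrow> integrable (lebesgue_on \<Omega>) f"
  using assms by (simp add: set_integrable_def integrable_restrict_space)

lemma LINT_lebesgue_on:
  fixes f :: "real^'d \<Rightarrow> 'b::euclidean_space"
  assumes "\<Omega> \<in> sets lebesgue"
  shows "(LINT x:\<Omega>|lebesgue. f x) = (LINT x|lebesgue_on \<Omega>. f x)"
  using assms by (simp add: set_lebesgue_integral_def integral_restrict_space)

lemma L2_iff:
  fixes u :: "real^'d \<Rightarrow> 'b::euclidean_space"
  assumes "\<Omega> \<in> sets lebesgue"
  shows "L2 \<Omega> u \<longleftrightarrow> u \<in> borel_measurable (lebesgue_on \<Omega>) \<and> integrable (lebesgue_on \<Omega>) (\<lambda>x. (norm (u x))\<^sup>2)"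
  using assms
  by (simp add: L2_def set_borel_measurable_def borel_measurable_restrict_space_iff set_integrable_iff_lebesgue_on)

lemma ae_eq_on_iff:
  assumes "\<Omega> \<in> sets lebesgue"
  shows "ae_eq_on \<Omega> u w \<longleftrightarrow> (AE x in lebesgue_on \<Omega>. u x = w x)"
  using assms by (simp add: ae_eq_on_def AE_restrict_space_iff)

lemma l2norm_eq:
  fixes u :: "real^'d \<Rightarrow> 'b::euclidean_space"
  assumes "\<Omega> \<in> sets lebesgue"
  shows "l2norm \<Omega> u = sqrt (LINT x|lebesgue_on \<Omega>. (norm (u x))\<^sup>2)"
  using assms by (simp add: l2norm_def LINT_lebesgue_on)

lemma l2inner_eq:
  fixes u :: "real^'d \<Rightarrow> 'b::euclidean_space"
  assumes "\<Omega> \<in> sets lebesgue"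
  shows "l2inner \<Omega> u v = (LINT x|lebesgue_on \<Omega>. u x \<bullet> v x)"
  using assms by (simp add: l2inner_def LINT_lebesgue_on)

section \<open>Hilbert space estimates in L2\<close>

lemma L2_mult_norm_integrable:
  fixes u :: "real^'d \<Rightarrow> 'b::euclidean_space" and v :: "real^'d \<Rightarrow> 'c::euclidean_space"
  assumes "\<Omega> \<in> sets lebesgue" "L2 \<Omega> u" "L2 \<Omega> v"
  shows "integrable (lebesgue_on \<Omega>) (\<lambda>x. norm (u x) * norm (v x))"
proof (rule Bochner_Integration.integrable_bound)
  show "integrable (lebesgue_on \<Omega>) (\<lambda>x. (norm (u x))\<^sup>2 + (norm (v x))\<^sup>2)"
    using assms by (auto simp: L2_iff)
  show "(\<lambda>x. norm (u x) * norm (v x)) \<in> borel_measurable (lebesgue_on \<Omega>)"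
    using assms by (auto simp: L2_iff)
  have "2 * (a * b) \<le> a\<^sup>2 + b\<^sup>2" for a b :: real using sum_squares_bound[of a b] by simp
  then have "a * b \<le> a\<^sup>2 + b\<^sup>2" if "a \<ge> 0" "b \<ge> 0" for a b :: real
    using that mult_nonneg_nonneg[OF that] by (smt (verit))
  then show "AE x in lebesgue_on \<Omega>. norm (norm (u x) * norm (v x)) \<le> norm ((norm (u x))\<^sup>2 + (norm (v x))\<^sup>2)"
    by (auto intro!: AE_I2)
qed

lemma L2_inner_integrable:
  fixes u v :: "real^'d \<Rightarrow> 'b::euclidean_space"
  assumes "\<Omega> \<in> sets lebesgue" "L2 \<Omega> u" "L2 \<Omega> v"
  shows "integrable (lebesgue_on \<Omega>) (\<lambda>x. u x \<bullet> v x)"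
  by (rule Bochner_Integration.integrable_bound[OF L2_mult_norm_integrable[OF assms]])
    (use assms in \<open>auto simp: L2_iff intro!: AE_I2 Cauchy_Schwarz_ineq2 borel_measurable_inner\<close>)

lemma L2_lincomb:
  fixes u v :: "real^'d \<Rightarrow> 'b::euclidean_space"
  assumes \<Omega>: "\<Omega> \<in> sets lebesgue" and "L2 \<Omega> u" "L2 \<Omega> v"
  shows "L2 \<Omega> (\<lambda>x. a *\<^sub>R u x + b *\<^sub>R v x)"
proof -
  have "(norm (a *\<^sub>R u x + b *\<^sub>R v x))\<^sup>2 = a\<^sup>2 * (norm (u x))\<^sup>2 + 2 * a * b * (u x \<bullet> v x) + b\<^sup>2 * (norm (v x))\<^sup>2" for x
    unfolding power2_norm_eq_inner by (simp add: algebra_simps inner_commute power2_eq_square)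
  then show ?thesis using assms L2_inner_integrable[OF assms] by (auto simp: L2_iff)
qed

lemma L2_diff:
  fixes u v :: "real^'d \<Rightarrow> 'b::euclidean_space"
  assumes "\<Omega> \<in> sets lebesgue" "L2 \<Omega> u" "L2 \<Omega> v"
  shows "L2 \<Omega> (\<lambda>x. u x - v x)"
  using L2_lincomb[OF assms, of 1 "-1"] by simp

lemma L2_nth:
  fixes u :: "real^'d \<Rightarrow> 'b::euclidean_space^'n"
  assumes \<Omega>: "\<Omega> \<in> sets lebesgue" and u: "L2 \<Omega> u"
  shows "L2 \<Omega> (\<lambda>x. u x $ i)"
proof -
  have m: "(\<lambda>x. u x $ i) \<in> borel_measurable (lebesgue_on \<Omega>)"
    by (rule measurable_compose[of u _ borel])
      (use u in \<open>auto simp: L2_iff[OF \<Omega>] intro!: borel_measurable_continuous_onI continuous_intros\<close>)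
  moreover have "integrable (lebesgue_on \<Omega>) (\<lambda>x. (norm (u x $ i))\<^sup>2)"
    by (rule Bochner_Integration.integrable_bound[where f="\<lambda>x. (norm (u x))\<^sup>2"])
      (use u \<Omega> m in \<open>auto simp: L2_iff intro!: AE_I2 power_mono Finite_Cartesian_Product.norm_nth_le\<close>)
  ultimately show ?thesis using \<Omega> by (simp add: L2_iff)
qed

lemma l2norm_nonneg: "0 \<le> l2norm \<Omega> u"
  unfolding l2norm_def set_lebesgue_integral_def by (simp add: Bochner_Integration.integral_nonneg)

lemma l2norm_square: "(l2norm \<Omega> u)\<^sup>2 = l2inner \<Omega> u u"
  unfolding l2norm_def l2inner_def set_lebesgue_integral_def
  by (simp add: Bochner_Integration.integral_nonneg power2_norm_eq_inner)

text \<open>The discriminant argument behind Cauchy-Schwarz, for a quadratic in \<open>t\<close>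
  that is never negative.\<close>

lemma square_le_mult_of_quadratic:
  fixes A B c :: real
  assumes "\<And>t. 2 * t * c \<le> A + t\<^sup>2 * B" "B \<ge> 0"
  shows "c\<^sup>2 \<le> A * B"
proof (cases "B = 0")
  case True
  have "c = 0"
  proof (rule ccontr)
    assume "c \<noteq> 0"
    \<comment> \<open>This \<open>t\<close> makes the left side of the hypothesis
      \<open>A + 1\<close>, while the right side is \<open>A\<close> because
      \<open>B = 0\<close>.\<close>
    then have "2 * ((A + 1) / (2 * c)) * c = A + 1" by simp
    then show False using assms(1)[of "(A + 1) / (2 * c)"] True by simp
  qed
  then show ?thesis using True by simp
next
  case False
  then have "B > 0" using assms(2) by simp
  \<comment> \<open>The quadratic attains its minimum at \<open>c / B\<close>.\<close>
  then show ?thesis using assms(1)[of "c / B"] by (simp add: field_simps power2_eq_square)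
qed

lemma l2_Cauchy_Schwarz:
  fixes u v :: "real^'d \<Rightarrow> 'b::euclidean_space"
  assumes \<Omega>: "\<Omega> \<in> sets lebesgue" and uv: "L2 \<Omega> u" "L2 \<Omega> v"
  shows "l2inner \<Omega> u v \<le> l2norm \<Omega> u * l2norm \<Omega> v"
proof -
  note int = L2_inner_integrable[OF \<Omega>]
  have "2 * t * l2inner \<Omega> u v \<le> l2inner \<Omega> u u + t\<^sup>2 * l2inner \<Omega> v v" for t
  proof -
    have "0 \<le> (LINT x|lebesgue_on \<Omega>. (u x - t *\<^sub>R v x) \<bullet> (u x - t *\<^sub>R v x))" by simp
    also have "\<dots> = (LINT x|lebesgue_on \<Omega>. u x \<bullet> u x - 2 * t * (u x \<bullet> v x) + t\<^sup>2 * (v x \<bullet> v x))"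
      by (simp add: algebra_simps inner_commute power2_eq_square)
    also have "\<dots> = l2inner \<Omega> u u - 2 * t * l2inner \<Omega> u v + t\<^sup>2 * l2inner \<Omega> v v"
      using int[OF uv] int[OF uv(1) uv(1)] int[OF uv(2) uv(2)] by (simp add: l2inner_eq[OF \<Omega>])
    finally show ?thesis by simp
  qed
  then have "(l2inner \<Omega> u v)\<^sup>2 \<le> l2inner \<Omega> u u * l2inner \<Omega> v v"
    by (rule square_le_mult_of_quadratic) (simp add: l2norm_square[symmetric])
  then have "(l2inner \<Omega> u v)\<^sup>2 \<le> (l2norm \<Omega> u * l2norm \<Omega> v)\<^sup>2"
    by (simp add: l2norm_square power_mult_distrib)
  then show ?thesis by (rule power2_le_imp_le) (simp add: l2norm_nonneg)
qed

lemma l2norm_lincomb_le: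
  fixes u v :: "real^'d \<Rightarrow> 'b::euclidean_space"
  assumes \<Omega>: "\<Omega> \<in> sets lebesgue" and uv: "L2 \<Omega> u" "L2 \<Omega> v"
  shows "l2norm \<Omega> (\<lambda>x. a *\<^sub>R u x + b *\<^sub>R v x) \<le> \<bar>a\<bar> * l2norm \<Omega> u + \<bar>b\<bar> * l2norm \<Omega> v"
proof (rule power2_le_imp_le)
  note int = L2_inner_integrable[OF \<Omega>]
  have "(l2norm \<Omega> (\<lambda>x. a *\<^sub>R u x + b *\<^sub>R v x))\<^sup>2
      = (LINT x|lebesgue_on \<Omega>. a\<^sup>2 * (u x \<bullet> u x) + 2 * a * b * (u x \<bullet> v x) + b\<^sup>2 * (v x \<bullet> v x))"
    unfolding l2norm_square l2inner_eq[OF \<Omega>] by (simp add: algebra_simps inner_commute power2_eq_square)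
  also have "\<dots> = a\<^sup>2 * l2inner \<Omega> u u + 2 * a * b * l2inner \<Omega> u v + b\<^sup>2 * l2inner \<Omega> v v"
    using int[OF uv] int[OF uv(1) uv(1)] int[OF uv(2) uv(2)] by (simp add: l2inner_eq[OF \<Omega>])
  also have "2 * a * b * l2inner \<Omega> u v \<le> 2 * \<bar>a * b\<bar> * (l2norm \<Omega> u * l2norm \<Omega> v)"
  proof -
    \<comment> \<open>The lower bound on the inner product is Cauchy-Schwarz for -u, written as a
      linear combination so that \<open>L2_lincomb\<close> applies.\<close>
    have "l2inner \<Omega> (\<lambda>x. (-1) *\<^sub>R u x + 0 *\<^sub>R u x) v \<le> l2norm \<Omega> (\<lambda>x. (-1) *\<^sub>R u x + 0 *\<^sub>R u x) * l2norm \<Omega> v"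
      by (intro l2_Cauchy_Schwarz L2_lincomb \<Omega> uv)
    then have "- l2inner \<Omega> u v \<le> l2norm \<Omega> u * l2norm \<Omega> v"
      by (simp add: l2inner_eq[OF \<Omega>] l2norm_eq[OF \<Omega>])
    then have "\<bar>l2inner \<Omega> u v\<bar> \<le> l2norm \<Omega> u * l2norm \<Omega> v" using l2_Cauchy_Schwarz[OF \<Omega> uv] by simp
    then have "\<bar>a * b\<bar> * \<bar>l2inner \<Omega> u v\<bar> \<le> \<bar>a * b\<bar> * (l2norm \<Omega> u * l2norm \<Omega> v)" by (intro mult_left_mono) auto
    then have "(a * b) * l2inner \<Omega> u v \<le> \<bar>a * b\<bar> * (l2norm \<Omega> u * l2norm \<Omega> v)"
      by (metis abs_ge_self abs_mult order_trans)
    then show ?thesis by simp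
  qed
  finally show "(l2norm \<Omega> (\<lambda>x. a *\<^sub>R u x + b *\<^sub>R v x))\<^sup>2 \<le> (\<bar>a\<bar> * l2norm \<Omega> u + \<bar>b\<bar> * l2norm \<Omega> v)\<^sup>2"
    by (simp add: power2_sum power_mult_distrib l2norm_square abs_mult mult_ac)
qed (simp add: l2norm_nonneg)

lemma l2norm_cong_ae:
  fixes u v :: "real^'d \<Rightarrow> 'b::euclidean_space"
  assumes \<Omega>: "\<Omega> \<in> sets lebesgue" and "L2 \<Omega> u" "L2 \<Omega> v" "ae_eq_on \<Omega> u v"
  shows "l2norm \<Omega> u = l2norm \<Omega> v"
  using assms unfolding l2norm_eq[OF \<Omega>]
  by (intro arg_cong[where f=sqrt] integral_cong_AE) (auto simp: L2_iff ae_eq_on_iff)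

lemma ae_zero_if_l2norm_zero:
  fixes u :: "real^'d \<Rightarrow> 'b::euclidean_space"
  assumes \<Omega>: "\<Omega> \<in> sets lebesgue" and u: "L2 \<Omega> u" and z: "l2norm \<Omega> u = 0"
  shows "AE x in lebesgue_on \<Omega>. u x = 0"
proof -
  have "(LINT x|lebesgue_on \<Omega>. (norm (u x))\<^sup>2) = 0" using z by (simp add: l2norm_eq[OF \<Omega>])
  then have "AE x in lebesgue_on \<Omega>. (norm (u x))\<^sup>2 = 0"
    using u by (subst (asm) integral_nonneg_eq_0_iff_AE) (auto simp: L2_iff[OF \<Omega>])
  then show ?thesis by simp
qed

lemma test_fun_L2:
  fixes \<phi> :: "real^'d \<Rightarrow> real"
  assumes "\<Omega> \<in> sets lebesgue" "test_fun \<Omega> \<phi>" shows "L2 \<Omega> \<phi>"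
proof -
  have "integrable lborel (\<lambda>x. \<phi> x * \<phi> x)"
    using test_fun_integrable[OF test_fun_mult] assms test_fun_smooth by blast
  then have "integrable lebesgue (\<lambda>x. \<phi> x * \<phi> x)" by (simp add: integrable_completion)
  then have "integrable (lebesgue_on \<Omega>) (\<lambda>x. \<phi> x * \<phi> x)"
    using assms(1) integrable_mult_indicator[OF assms(1), of "\<lambda>x. \<phi> x * \<phi> x"]
    by (simp add: integrable_restrict_space)
  moreover have "\<phi> \<in> borel_measurable (lebesgue_on \<Omega>)"
    using test_fun_borel[OF assms(2)] by (intro measurable_restrict_space1 measurable_completion) simp
  ultimately show ?thesis by (simp add: L2_iff[OF assms(1)] power2_eq_square)
qed

lemma borel_measurable_vecI:
  fixes f :: "'a \<Rightarrow> 'b::euclidean_space^'n"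
  assumes "\<And>i. (\<lambda>x. f x $ i) \<in> borel_measurable M"
  shows "f \<in> borel_measurable M"
  by (subst borel_measurable_euclidean_space)
    (use assms in \<open>auto simp: Basis_vec_def inner_axis intro!: borel_measurable_inner\<close>)

lemma L2_vecI:
  fixes u :: "real^'d \<Rightarrow> 'b::euclidean_space^'n"
  assumes \<Omega>: "\<Omega> \<in> sets lebesgue" and u: "\<And>i. L2 \<Omega> (\<lambda>x. u x $ i)"
  shows "L2 \<Omega> u"
proof -
  have "(norm (u x))\<^sup>2 = (\<Sum>i\<in>UNIV. (norm (u x $ i))\<^sup>2)" for x
    by (simp add: norm_vec_def L2_set_def sum_nonneg)
  then show ?thesis using u by (auto simp: L2_iff[OF \<Omega>] intro!: borel_measurable_vecI)
qed

text \<open>The constant 1 is square integrable because \<open>\<Omega>\<close> has finite measure;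
  pairing with it yields the integrability that \<open>fundamental_lemma\<close> asks for.\<close>

lemma L2_integrable:
  fixes u :: "real^'d \<Rightarrow> 'b::euclidean_space"
  assumes \<Omega>: "\<Omega> \<in> lmeasurable" and u: "L2 \<Omega> u"
  shows "integrable (lebesgue_on \<Omega>) u"
proof -
  have s: "\<Omega> \<in> sets lebesgue" using \<Omega> by auto
  have "L2 \<Omega> (\<lambda>_. 1::real)"
    using finite_measure.integrable_const[OF finite_measure_lebesgue_on[OF \<Omega>]] by (simp add: L2_iff[OF s])
  from L2_mult_norm_integrable[OF s u this] show ?thesis
    using u s by (auto simp: L2_iff integrable_norm_iff)
qed

text \<open>Entry by entry, two weak gradients have the same pairing with every test function, so
  the fundamental lemma applies to the difference.\<close>

lemma weak_grad_unique:
  fixes u :: "real^'d \<Rightarrow> real^'d"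
  assumes op: "open \<Omega>" and \<Omega>: "\<Omega> \<in> lmeasurable"
    and G: "L2 \<Omega> G" "is_weak_grad \<Omega> u G" and G': "L2 \<Omega> G'" "is_weak_grad \<Omega> u G'"
  shows "ae_eq_on \<Omega> G G'"
proof -
  have s: "\<Omega> \<in> sets lebesgue" using \<Omega> by auto
  have L: "L2 \<Omega> (\<lambda>x. K x $ i $ j)" if "L2 \<Omega> K" for i j and K :: "real^'d \<Rightarrow> real^'d^'d"
    by (intro L2_nth s that)
  have "AE x in lebesgue. x \<in> \<Omega> \<longrightarrow> G x $ i $ j - G' x $ i $ j = 0" for i j
  proof (rule fundamental_lemma[OF op])
    show "set_integrable lebesgue \<Omega> (\<lambda>x. G x $ i $ j - G' x $ i $ j)"
      unfolding set_integrable_iff_lebesgue_on[OF s] by (intro L2_integrable \<Omega> L2_diff s L G G')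
    fix \<phi> assume \<phi>: "test_fun \<Omega> \<phi>"
    have "integrable (lebesgue_on \<Omega>) (\<lambda>x. K x $ i $ j * \<phi> x)" if "L2 \<Omega> K" for K :: "real^'d \<Rightarrow> real^'d^'d"
      using L2_inner_integrable[OF s L[OF that] test_fun_L2[OF s \<phi>]] by simp
    moreover have "(LINT x:\<Omega>|lebesgue. G x $ i $ j * \<phi> x) = (LINT x:\<Omega>|lebesgue. G' x $ i $ j * \<phi> x)"
      using G(2)[unfolded is_weak_grad_def, rule_format, OF \<phi>, of i j]
        G'(2)[unfolded is_weak_grad_def, rule_format, OF \<phi>, of i j] by simp
    ultimately show "(LINT x:\<Omega>|lebesgue. (G x $ i $ j - G' x $ i $ j) * \<phi> x) = 0"
      using G G' by (simp add: left_diff_distrib LINT_lebesgue_on[OF s])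
  qed
  then have "AE x in lebesgue. \<forall>i j. x \<in> \<Omega> \<longrightarrow> G x $ i $ j - G' x $ i $ j = 0"
    unfolding AE_all_countable by blast
  then show ?thesis unfolding ae_eq_on_def by eventually_elim (simp add: vec_eq_iff)
qed

lemma H1_grad:
  assumes "H1 \<Omega> u" shows "L2 \<Omega> (grad \<Omega> u)" "is_weak_grad \<Omega> u (grad \<Omega> u)"
  using assms someI_ex[of "\<lambda>G. L2 \<Omega> G \<and> is_weak_grad \<Omega> u G"] unfolding H1_def grad_def by auto

text \<open>Since \<open>grad\<close> is a choice, facts about it are obtained by exhibiting some
  square integrable weak gradient and comparing up to null sets.\<close>

lemma grad_ae_eq:
  assumes op: "open \<Omega>" and \<Omega>: "\<Omega> \<in> lmeasurable"
    and u: "L2 \<Omega> u" "L2 \<Omega> G" "is_weak_grad \<Omega> u G"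
  shows "H1 \<Omega> u" "ae_eq_on \<Omega> (grad \<Omega> u) G"
proof -
  show "H1 \<Omega> u" using u by (auto simp: H1_def)
  from weak_grad_unique[OF op \<Omega> H1_grad[OF this] u(2,3)] show "ae_eq_on \<Omega> (grad \<Omega> u) G" .
qed

lemma grad_lincomb:
  assumes op: "open \<Omega>" and \<Omega>: "\<Omega> \<in> lmeasurable" and u: "H1 \<Omega> u" and v: "H1 \<Omega> v"
  shows "H1 \<Omega> (\<lambda>x. a *\<^sub>R u x + b *\<^sub>R v x)"
    "ae_eq_on \<Omega> (grad \<Omega> (\<lambda>x. a *\<^sub>R u x + b *\<^sub>R v x)) (\<lambda>x. a *\<^sub>R grad \<Omega> u x + b *\<^sub>R grad \<Omega> v x)"
proof -
  have s: "\<Omega> \<in> sets lebesgue" using \<Omega> by auto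
  have Lu: "L2 \<Omega> u" "L2 \<Omega> v" using u v by (auto simp: H1_def)
  have wg: "is_weak_grad \<Omega> (\<lambda>x. a *\<^sub>R u x + b *\<^sub>R v x) (\<lambda>x. a *\<^sub>R grad \<Omega> u x + b *\<^sub>R grad \<Omega> v x)"
    unfolding is_weak_grad_def
  proof (intro allI impI)
    fix \<phi> i j assume \<phi>: "test_fun \<Omega> \<phi>"
    have I: "integrable (lebesgue_on \<Omega>) (\<lambda>x. w x * \<psi> x)" if "L2 \<Omega> w" "test_fun \<Omega> \<psi>" for w \<psi> :: "real^'a \<Rightarrow> real"
      using L2_inner_integrable[OF s that(1) test_fun_L2[OF s that(2)]] by simp
    note I1 = I[OF L2_nth[OF s] test_fun_partial[OF \<phi>]]
    note I2 = I[OF L2_nth[OF s L2_nth[OF s]] \<phi>]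
    have "(LINT x:\<Omega>|lebesgue. (a *\<^sub>R u x + b *\<^sub>R v x) $ i * partial j \<phi> x) =
        a * (LINT x:\<Omega>|lebesgue. u x $ i * partial j \<phi> x) + b * (LINT x:\<Omega>|lebesgue. v x $ i * partial j \<phi> x)"
      using I1[OF Lu(1)] I1[OF Lu(2)] by (simp add: distrib_right LINT_lebesgue_on[OF s] mult.assoc)
    also have "\<dots> = - (a * (LINT x:\<Omega>|lebesgue. grad \<Omega> u x $ i $ j * \<phi> x) + b * (LINT x:\<Omega>|lebesgue. grad \<Omega> v x $ i $ j * \<phi> x))"
      using H1_grad(2)[OF u] H1_grad(2)[OF v] \<phi> by (simp add: is_weak_grad_def)
    also have "\<dots> = - (LINT x:\<Omega>|lebesgue. (a *\<^sub>R grad \<Omega> u x + b *\<^sub>R grad \<Omega> v x) $ i $ j * \<phi> x)"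
      using I2[OF H1_grad(1)[OF u]] I2[OF H1_grad(1)[OF v]] by (simp add: distrib_right LINT_lebesgue_on[OF s] mult.assoc)
    finally show "(LINT x:\<Omega>|lebesgue. (a *\<^sub>R u x + b *\<^sub>R v x) $ i * partial j \<phi> x) =
      - (LINT x:\<Omega>|lebesgue. (a *\<^sub>R grad \<Omega> u x + b *\<^sub>R grad \<Omega> v x) $ i $ j * \<phi> x)" .
  qed
  from grad_ae_eq[OF op \<Omega> _ _ wg]
  show "H1 \<Omega> (\<lambda>x. a *\<^sub>R u x + b *\<^sub>R v x)"
    "ae_eq_on \<Omega> (grad \<Omega> (\<lambda>x. a *\<^sub>R u x + b *\<^sub>R v x)) (\<lambda>x. a *\<^sub>R grad \<Omega> u x + b *\<^sub>R grad \<Omega> v x)"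
    using Lu H1_grad(1)[OF u] H1_grad(1)[OF v] s by (auto intro: L2_lincomb)
qed

lemma test_field_grad:
  assumes op: "open \<Omega>" and \<Omega>: "\<Omega> \<in> lmeasurable" and \<phi>: "test_field \<Omega> \<phi>"
  shows "H1 \<Omega> \<phi>" "ae_eq_on \<Omega> (grad \<Omega> \<phi>) (\<lambda>x. \<chi> i j. partial j (\<lambda>x. \<phi> x $ i) x)"
proof -
  have s: "\<Omega> \<in> sets lebesgue" using \<Omega> by auto
  have t: "test_fun \<Omega> (\<lambda>x. \<phi> x $ i)" for i using \<phi> by (simp add: test_field_def)
  have "L2 \<Omega> \<phi>" by (intro L2_vecI s test_fun_L2 t)
  moreover have "L2 \<Omega> (\<lambda>x. \<chi> i j. partial j (\<lambda>x. \<phi> x $ i) x)"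
    by (intro L2_vecI s) (simp add: test_fun_L2 s test_fun_partial t)
  moreover have "is_weak_grad \<Omega> \<phi> (\<lambda>x. \<chi> i j. partial j (\<lambda>x. \<phi> x $ i) x)"
    unfolding is_weak_grad_def using test_fun_integration_by_parts[OF t] by simp
  ultimately show "H1 \<Omega> \<phi>" "ae_eq_on \<Omega> (grad \<Omega> \<phi>) (\<lambda>x. \<chi> i j. partial j (\<lambda>x. \<phi> x $ i) x)"
    using grad_ae_eq[OF op \<Omega>] by auto
qed

section \<open>X as a linear space containing the test fields\<close>

lemma test_field_lincomb:
  assumes "test_field \<Omega> \<phi>" "test_field \<Omega> \<psi>"
  shows "test_field \<Omega> (\<lambda>x. a *\<^sub>R \<phi> x + b *\<^sub>R \<psi> x)"
  using assms by (auto simp: test_field_def intro!: test_fun_add test_fun_cmult)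

lemma test_field_in_Xsp:
  assumes "open \<Omega>" "\<Omega> \<in> lmeasurable" "test_field \<Omega> \<phi>" shows "\<phi> \<in> Xsp \<Omega>"
  using assms test_field_grad(1)[OF assms]
  by (auto simp: Xsp_def l2norm_def intro!: exI[of _ "\<lambda>_. \<phi>"])

lemma Xsp_H1: "u \<in> Xsp \<Omega> \<Longrightarrow> H1 \<Omega> u"
  and Xsp_L2: "u \<in> Xsp \<Omega> \<Longrightarrow> L2 \<Omega> u"
  by (auto simp: Xsp_def H1_def)

lemma Xsp_grad_L2: "u \<in> Xsp \<Omega> \<Longrightarrow> L2 \<Omega> (grad \<Omega> u)"
  by (intro H1_grad(1) Xsp_H1)

lemma Xsp_lincomb:
  assumes op: "open \<Omega>" and \<Omega>: "\<Omega> \<in> lmeasurable" and u: "u \<in> Xsp \<Omega>" and v: "v \<in> Xsp \<Omega>"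
  shows "(\<lambda>x. a *\<^sub>R u x + b *\<^sub>R v x) \<in> Xsp \<Omega>"
proof -
  have s: "\<Omega> \<in> sets lebesgue" using \<Omega> by auto
  define w where "w = (\<lambda>x. a *\<^sub>R u x + b *\<^sub>R v x)"
  obtain \<phi> where \<phi>: "\<And>n. test_field \<Omega> (\<phi> n)"
    and lim\<phi>: "(\<lambda>n. l2norm \<Omega> (\<lambda>x. \<phi> n x - u x) + l2norm \<Omega> (\<lambda>x. grad \<Omega> (\<phi> n) x - grad \<Omega> u x)) \<longlonglongrightarrow> 0"
    using u unfolding Xsp_def by blast
  obtain \<psi> where \<psi>: "\<And>n. test_field \<Omega> (\<psi> n)"
    and lim\<psi>: "(\<lambda>n. l2norm \<Omega> (\<lambda>x. \<psi> n x - v x) + l2norm \<Omega> (\<lambda>x. grad \<Omega> (\<psi> n) x - grad \<Omega> v x)) \<longlonglongrightarrow> 0"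
    using v unfolding Xsp_def by blast
  define \<eta> where "\<eta> n = (\<lambda>x. a *\<^sub>R \<phi> n x + b *\<^sub>R \<psi> n x)" for n
  have \<eta>: "test_field \<Omega> (\<eta> n)" for n unfolding \<eta>_def by (intro test_field_lincomb \<phi> \<psi>)
  note H = test_field_grad(1)[OF op \<Omega>]
  have Hw: "H1 \<Omega> w" unfolding w_def by (intro grad_lincomb(1) op \<Omega> Xsp_H1 u v)
  have LH: "L2 \<Omega> f" if "H1 \<Omega> f" for f :: "real^'a \<Rightarrow> real^'a" using that by (simp add: H1_def)
  let ?e = "\<lambda>n. (l2norm \<Omega> (\<lambda>x. \<eta> n x - w x) + l2norm \<Omega> (\<lambda>x. grad \<Omega> (\<eta> n) x - grad \<Omega> w x))"
  let ?b = "\<lambda>n. \<bar>a\<bar> * (l2norm \<Omega> (\<lambda>x. \<phi> n x - u x) + l2norm \<Omega> (\<lambda>x. grad \<Omega> (\<phi> n) x - grad \<Omega> u x)) +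
     \<bar>b\<bar> * (l2norm \<Omega> (\<lambda>x. \<psi> n x - v x) + l2norm \<Omega> (\<lambda>x. grad \<Omega> (\<psi> n) x - grad \<Omega> v x))"
  have "?e n \<le> ?b n" for n
  proof -
    have "l2norm \<Omega> (\<lambda>x. \<eta> n x - w x) = l2norm \<Omega> (\<lambda>x. a *\<^sub>R (\<phi> n x - u x) + b *\<^sub>R (\<psi> n x - v x))"
      unfolding \<eta>_def w_def by (simp add: algebra_simps)
    also have "\<dots> \<le> \<bar>a\<bar> * l2norm \<Omega> (\<lambda>x. \<phi> n x - u x) + \<bar>b\<bar> * l2norm \<Omega> (\<lambda>x. \<psi> n x - v x)"
      by (intro l2norm_lincomb_le L2_diff s LH H \<phi> \<psi> Xsp_L2 u v)
    finally have 1: "l2norm \<Omega> (\<lambda>x. \<eta> n x - w x) \<le> \<bar>a\<bar> * l2norm \<Omega> (\<lambda>x. \<phi> n x - u x) + \<bar>b\<bar> * l2norm \<Omega> (\<lambda>x. \<psi> n x - v x)" .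
    \<comment> \<open>The gradient of a combination is the combination of the gradients only almost
      everywhere, so the norms are compared through \<open>l2norm_cong_ae\<close>.\<close>
    have ae: "ae_eq_on \<Omega> (\<lambda>x. grad \<Omega> (\<eta> n) x - grad \<Omega> w x)
        (\<lambda>x. a *\<^sub>R (grad \<Omega> (\<phi> n) x - grad \<Omega> u x) + b *\<^sub>R (grad \<Omega> (\<psi> n) x - grad \<Omega> v x))"
      using grad_lincomb(2)[OF op \<Omega> H[OF \<phi>[of n]] H[OF \<psi>[of n]], where a=a and b=b]
        grad_lincomb(2)[OF op \<Omega> Xsp_H1[OF u] Xsp_H1[OF v], where a=a and b=b]
      unfolding \<eta>_def[symmetric] w_def[symmetric] ae_eq_on_def
      by eventually_elim (simp add: algebra_simps)
    have "l2norm \<Omega> (\<lambda>x. grad \<Omega> (\<eta> n) x - grad \<Omega> w x) =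
       l2norm \<Omega> (\<lambda>x. a *\<^sub>R (grad \<Omega> (\<phi> n) x - grad \<Omega> u x) + b *\<^sub>R (grad \<Omega> (\<psi> n) x - grad \<Omega> v x))"
      by (rule l2norm_cong_ae[OF s _ _ ae])
        (intro L2_diff L2_lincomb s H1_grad(1) H \<phi> \<psi> \<eta> Hw Xsp_H1 u v)+
    also have "\<dots> \<le> \<bar>a\<bar> * l2norm \<Omega> (\<lambda>x. grad \<Omega> (\<phi> n) x - grad \<Omega> u x) + \<bar>b\<bar> * l2norm \<Omega> (\<lambda>x. grad \<Omega> (\<psi> n) x - grad \<Omega> v x)"
      by (intro l2norm_lincomb_le L2_diff s H1_grad(1) H \<phi> \<psi> Xsp_H1 u v)
    finally show ?thesis using 1 by (simp add: algebra_simps)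
  qed
  moreover have "?b \<longlonglongrightarrow> \<bar>a\<bar> * 0 + \<bar>b\<bar> * 0" by (intro tendsto_intros lim\<phi> lim\<psi>)
  moreover have "0 \<le> ?e n" for n by (simp add: l2norm_nonneg)
  ultimately have "?e \<longlonglongrightarrow> 0"
    by (intro tendsto_sandwich[of "\<lambda>_. 0" ?e sequentially ?b]) auto
  then show ?thesis using Hw \<eta> unfolding Xsp_def w_def by auto
qed

section \<open>An L4 bound for test functions\<close>


text \<open>Bounding \<open>p\<close> once along each variable gives p(s,t)^2 \<le> Q(t) R(s). The
  factors depend on different variables, so the double integral splits: the planar core of
  Ladyzhenskaya's inequality.\<close>

lemma nn_integral_square_le_product:
  assumes "sigma_finite_measure M" "sigma_finite_measure N"
    and [measurable]: "p \<in> borel_measurable (M \<Otimes>\<^sub>M N)" "q \<in> borel_measurable (M \<Otimes>\<^sub>M N)" "r \<in> borel_measurable (M \<Otimes>\<^sub>M N)"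
    and q: "\<And>s t. p (s, t) \<le> (\<integral>\<^sup>+ s'. q (s', t) \<partial>M)"
    and r: "\<And>s t. p (s, t) \<le> (\<integral>\<^sup>+ t'. r (s, t') \<partial>N)"
  shows "(\<integral>\<^sup>+ x. (p x)\<^sup>2 \<partial>(M \<Otimes>\<^sub>M N)) \<le> (\<integral>\<^sup>+ x. q x \<partial>(M \<Otimes>\<^sub>M N)) * (\<integral>\<^sup>+ x. r x \<partial>(M \<Otimes>\<^sub>M N))"
proof -
  interpret M: sigma_finite_measure M by fact
  interpret N: sigma_finite_measure N by fact
  interpret P: pair_sigma_finite M N ..
  define Q where "Q t = (\<integral>\<^sup>+ s. q (s, t) \<partial>M)" for t
  define R where "R s = (\<integral>\<^sup>+ t. r (s, t) \<partial>N)" for s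
  have [measurable]: "Q \<in> borel_measurable N" "R \<in> borel_measurable M" unfolding Q_def R_def by measurable
  have "(\<integral>\<^sup>+ x. (p x)\<^sup>2 \<partial>(M \<Otimes>\<^sub>M N)) \<le> (\<integral>\<^sup>+ x. Q (snd x) * R (fst x) \<partial>(M \<Otimes>\<^sub>M N))"
    using q r by (intro nn_integral_mono) (auto simp: Q_def R_def power2_eq_square intro!: mult_mono)
  also have "\<dots> = (\<integral>\<^sup>+ s. \<integral>\<^sup>+ t. Q t * R s \<partial>N \<partial>M)"
    by (subst N.nn_integral_fst[symmetric]) auto
  also have "\<dots> = (\<integral>\<^sup>+ t. Q t \<partial>N) * (\<integral>\<^sup>+ s. R s \<partial>M)"
    by (simp add: nn_integral_multc nn_integral_cmult)
  also have "(\<integral>\<^sup>+ t. Q t \<partial>N) = (\<integral>\<^sup>+ x. q x \<partial>(M \<Otimes>\<^sub>M N))"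
    unfolding Q_def by (rule P.nn_integral_snd) simp
  also have "(\<integral>\<^sup>+ s. R s \<partial>M) = (\<integral>\<^sup>+ x. r x \<partial>(M \<Otimes>\<^sub>M N))"
    unfolding R_def by (rule N.nn_integral_fst) simp
  finally show ?thesis .
qed

text \<open>The factor 2 is that of (f^2)' = 2 f f', the integrand produced by the line estimates;
  its square is the 4 on the right.\<close>

lemma nn_integral_abs_mult_square_le:
  fixes f g :: "'a \<Rightarrow> real"
  assumes [measurable]: "f \<in> borel_measurable M" "g \<in> borel_measurable M"
  shows "(\<integral>\<^sup>+ x. ennreal (2 * \<bar>f x * g x\<bar>) \<partial>M)\<^sup>2 \<le> 4 * (\<integral>\<^sup>+ x. ennreal ((f x)\<^sup>2) \<partial>M) * (\<integral>\<^sup>+ x. ennreal ((g x)\<^sup>2) \<partial>M)"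
proof -
  have "(\<integral>\<^sup>+ x. ennreal (2 * \<bar>f x * g x\<bar>) \<partial>M)\<^sup>2 = (\<integral>\<^sup>+ x. ennreal (2 * \<bar>f x\<bar>) * ennreal \<bar>g x\<bar> \<partial>M)\<^sup>2"
    by (simp add: ennreal_mult[symmetric] abs_mult mult.assoc)
  also have "\<dots> \<le> (\<integral>\<^sup>+ x. (ennreal (2 * \<bar>f x\<bar>))\<^sup>2 \<partial>M) * (\<integral>\<^sup>+ x. (ennreal \<bar>g x\<bar>)\<^sup>2 \<partial>M)"
    by (rule Cauchy_Schwarz_nn_integral) auto
  also have "\<dots> = (\<integral>\<^sup>+ x. 4 * ennreal ((f x)\<^sup>2) \<partial>M) * (\<integral>\<^sup>+ x. ennreal ((g x)\<^sup>2) \<partial>M)"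
    by (simp add: ennreal_power power_mult_distrib ennreal_mult)
  finally show ?thesis by (simp add: nn_integral_cmult)
qed

lemma ennreal_mult_le_sum_squares: "(a::ennreal) * b \<le> a\<^sup>2 + b\<^sup>2"
proof (cases "a \<le> b")
  case True
  then have "a * b \<le> b * b" by (intro mult_right_mono) auto
  then show ?thesis by (simp add: power2_eq_square add_increasing)
next
  case False
  then have "a * b \<le> a * a" by (intro mult_left_mono) auto
  then show ?thesis by (simp add: power2_eq_square add_increasing2)
qed

text \<open>On each slice \<open>z = const\<close> the two-dimensional argument bounds the integral of \<open>f\<^sup>4\<close> by the product of two line integrals; Cauchy-Schwarz leaves the factor \<open>\<integral>f\<^sup>2\<close> over the slice, which is bounded uniformly in \<open>z\<close> through the third direction.\<close>

lemma nn_integral_power4_le_triple_product: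
  fixes f g1 g2 g3 :: "(real \<times> real) \<times> real \<Rightarrow> real"
  assumes [measurable]: "f \<in> borel_measurable borel" "g1 \<in> borel_measurable borel" "g2 \<in> borel_measurable borel" "g3 \<in> borel_measurable borel"
    and 1: "\<And>s t z. ennreal ((f ((s, t), z))\<^sup>2) \<le> (\<integral>\<^sup>+ s'. ennreal (2 * \<bar>f ((s', t), z) * g1 ((s', t), z)\<bar>) \<partial>lborel)"
    and 2: "\<And>s t z. ennreal ((f ((s, t), z))\<^sup>2) \<le> (\<integral>\<^sup>+ t'. ennreal (2 * \<bar>f ((s, t'), z) * g2 ((s, t'), z)\<bar>) \<partial>lborel)"
    and 3: "\<And>s t z. ennreal ((f ((s, t), z))\<^sup>2) \<le> (\<integral>\<^sup>+ z'. ennreal (2 * \<bar>f ((s, t), z') * g3 ((s, t), z')\<bar>) \<partial>lborel)"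
  shows "(\<integral>\<^sup>+ x. ennreal ((f x)^4) \<partial>lborel) \<le> 4 * (\<integral>\<^sup>+ x. ennreal (2 * \<bar>f x * g3 x\<bar>) \<partial>lborel)
     * ((\<integral>\<^sup>+ x. ennreal ((g1 x)\<^sup>2) \<partial>lborel) + (\<integral>\<^sup>+ x. ennreal ((g2 x)\<^sup>2) \<partial>lborel))"
proof -
  let ?S = "\<integral>\<^sup>+ x. ennreal (2 * \<bar>f x * g3 x\<bar>) \<partial>lborel"
  have fub: "(\<integral>\<^sup>+ x. h x \<partial>lborel) = (\<integral>\<^sup>+ z. \<integral>\<^sup>+ w. h (w, z) \<partial>lborel \<partial>lborel)"
    if "h \<in> borel_measurable borel" for h :: "(real \<times> real) \<times> real \<Rightarrow> ennreal"
  proof -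
    have "h \<in> borel_measurable (lborel \<Otimes>\<^sub>M lborel)" using that by (simp add: lborel_prod)
    from lborel_pair.nn_integral_snd[OF this] show ?thesis by (simp add: lborel_prod)
  qed
  have [measurable]: "(\<lambda>w. h (w, z)) \<in> borel_measurable borel" if "h \<in> borel_measurable borel"
    for h :: "(real \<times> real) \<times> real \<Rightarrow> real" and z
    using that by measurable
  have [measurable]: "f \<in> borel_measurable (borel \<Otimes>\<^sub>M borel)" "g1 \<in> borel_measurable (borel \<Otimes>\<^sub>M borel)"
     "g2 \<in> borel_measurable (borel \<Otimes>\<^sub>M borel)" "g3 \<in> borel_measurable (borel \<Otimes>\<^sub>M borel)"
    using assms(1-4) by (simp_all add: borel_prod)
  have slice: "(\<integral>\<^sup>+ w. ennreal ((f (w, z))^4) \<partial>lborel)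
      \<le> 4 * ?S * ((\<integral>\<^sup>+ w. ennreal ((g1 (w, z))\<^sup>2) \<partial>lborel) + (\<integral>\<^sup>+ w. ennreal ((g2 (w, z))\<^sup>2) \<partial>lborel))" for z
  proof -
    let ?A = "\<integral>\<^sup>+ w. ennreal (2 * \<bar>f (w, z) * g1 (w, z)\<bar>) \<partial>lborel"
    let ?B = "\<integral>\<^sup>+ w. ennreal (2 * \<bar>f (w, z) * g2 (w, z)\<bar>) \<partial>lborel"
    let ?P = "\<integral>\<^sup>+ w. ennreal ((f (w, z))\<^sup>2) \<partial>lborel"
    have P: "?P \<le> ?S"
    proof -
      have "?P \<le> (\<integral>\<^sup>+ w. \<integral>\<^sup>+ z'. ennreal (2 * \<bar>f (w, z') * g3 (w, z')\<bar>) \<partial>lborel \<partial>lborel)"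
      proof (rule nn_integral_mono)
        fix w :: "real \<times> real"
        show "ennreal ((f (w, z))\<^sup>2) \<le> (\<integral>\<^sup>+ z'. ennreal (2 * \<bar>f (w, z') * g3 (w, z')\<bar>) \<partial>lborel)"
          using 3[of "fst w" "snd w" z] by simp
      qed
      also have "\<dots> = ?S"
        by (subst lborel.nn_integral_fst) (simp_all add: lborel_prod)
      finally show ?thesis .
    qed
    have "(\<integral>\<^sup>+ w. ennreal ((f (w, z))^4) \<partial>lborel) = (\<integral>\<^sup>+ w. (ennreal ((f (w, z))\<^sup>2))\<^sup>2 \<partial>(lborel \<Otimes>\<^sub>M lborel))"
      by (simp add: ennreal_power lborel_prod)
    also have "\<dots> \<le> (\<integral>\<^sup>+ w. ennreal (2 * \<bar>f (w, z) * g1 (w, z)\<bar>) \<partial>(lborel \<Otimes>\<^sub>M lborel)) *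
       (\<integral>\<^sup>+ w. ennreal (2 * \<bar>f (w, z) * g2 (w, z)\<bar>) \<partial>(lborel \<Otimes>\<^sub>M lborel))"
      using 1 2 by (intro nn_integral_square_le_product) (auto simp: lborel.sigma_finite_measure_axioms lborel_prod)
    also have "\<dots> = ?A * ?B" by (simp add: lborel_prod)
    also have "\<dots> \<le> ?A\<^sup>2 + ?B\<^sup>2" by (rule ennreal_mult_le_sum_squares)
    also have "\<dots> \<le> 4 * ?P * (\<integral>\<^sup>+ w. ennreal ((g1 (w, z))\<^sup>2) \<partial>lborel) + 4 * ?P * (\<integral>\<^sup>+ w. ennreal ((g2 (w, z))\<^sup>2) \<partial>lborel)"
      by (intro add_mono nn_integral_abs_mult_square_le) auto
    also have "\<dots> = 4 * ?P * ((\<integral>\<^sup>+ w. ennreal ((g1 (w, z))\<^sup>2) \<partial>lborel) + (\<integral>\<^sup>+ w. ennreal ((g2 (w, z))\<^sup>2) \<partial>lborel))"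
      by (simp add: distrib_left)
    also have "\<dots> \<le> 4 * ?S * ((\<integral>\<^sup>+ w. ennreal ((g1 (w, z))\<^sup>2) \<partial>lborel) + (\<integral>\<^sup>+ w. ennreal ((g2 (w, z))\<^sup>2) \<partial>lborel))"
      by (intro mult_right_mono mult_left_mono P) auto
    finally show ?thesis .
  qed
  have "(\<integral>\<^sup>+ x. ennreal ((f x)^4) \<partial>lborel) = (\<integral>\<^sup>+ z. \<integral>\<^sup>+ w. ennreal ((f (w, z))^4) \<partial>lborel \<partial>lborel)"
    by (rule fub) simp
  also have "\<dots> \<le> (\<integral>\<^sup>+ z. 4 * ?S * ((\<integral>\<^sup>+ w. ennreal ((g1 (w, z))\<^sup>2) \<partial>lborel) + (\<integral>\<^sup>+ w. ennreal ((g2 (w, z))\<^sup>2) \<partial>lborel)) \<partial>lborel)"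
    by (intro nn_integral_mono slice)
  also have "\<dots> = 4 * ?S * ((\<integral>\<^sup>+ z. \<integral>\<^sup>+ w. ennreal ((g1 (w, z))\<^sup>2) \<partial>lborel \<partial>lborel) + (\<integral>\<^sup>+ z. \<integral>\<^sup>+ w. ennreal ((g2 (w, z))\<^sup>2) \<partial>lborel \<partial>lborel))"
    by (simp add: nn_integral_cmult nn_integral_add)
  also have "\<dots> = 4 * ?S * ((\<integral>\<^sup>+ x. ennreal ((g1 x)\<^sup>2) \<partial>lborel) + (\<integral>\<^sup>+ x. ennreal ((g2 x)\<^sup>2) \<partial>lborel))"
    by (simp add: fub)
  finally show ?thesis .
qed

text \<open>Lebesgue measure is determined by its values on boxes, and naming the coordinates turns
  boxes into products of intervals. This opens vectors over an abstract index type to Fubini's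
  theorem.\<close>

lemma lborel_vec2:
  fixes i j :: "'d::finite"
  assumes ij: "i \<noteq> j" "UNIV = {i, j}"
  shows "(lborel :: (real^'d) measure) = distr lborel borel (\<lambda>(s, t). s *\<^sub>R axis i 1 + t *\<^sub>R axis j 1)"
proof (rule lborel_eqI)
  let ?T = "\<lambda>(s, t). s *\<^sub>R axis i 1 + t *\<^sub>R axis j (1::real)"
  have m: "?T \<in> borel_measurable borel"
    by (intro borel_measurable_continuous_onI) (auto simp: case_prod_unfold intro!: continuous_intros)
  fix l u :: "real^'d" assume le: "\<And>b. b \<in> Basis \<Longrightarrow> l \<bullet> b \<le> u \<bullet> b"
  have "l $ k \<le> u $ k" for k using le[of "axis k 1"] by (simp add: inner_axis axis_in_Basis_iff)
  then have lek: "l $ i \<le> u $ i" "l $ j \<le> u $ j" by auto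
  have all: "(\<forall>k. P k) \<longleftrightarrow> P i \<and> P j" for P using ij(2) by (metis UNIV_I empty_iff insertE)
  have "?T -` box l u = {l$i<..<u$i} \<times> {l$j<..<u$j}"
    using ij(1) by (auto simp: mem_box_cart all axis_def)
  then have "emeasure (distr lborel borel ?T) (box l u) = emeasure (lborel \<Otimes>\<^sub>M lborel) ({l$i<..<u$i} \<times> {l$j<..<u$j})"
    using m by (simp add: emeasure_distr lborel_prod)
  also have "\<dots> = ennreal ((u$i - l$i) * (u$j - l$j))"
    using lek by (simp add: lborel.emeasure_pair_measure_Times ennreal_mult)
  also have "(u$i - l$i) * (u$j - l$j) = (\<Prod>k\<in>UNIV. u $ k - l $ k)"
    unfolding ij(2) using ij(1) by simp
  also have "\<dots> = (\<Prod>b\<in>Basis. (u - l) \<bullet> b)"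
    by (simp add: Basis_vec_def UNION_singleton_eq_range prod.reindex inj_on_def axis_eq_axis inner_axis)
  finally show "emeasure (distr lborel borel ?T) (box l u) = (\<Prod>b\<in>Basis. (u - l) \<bullet> b)" .
qed simp

text \<open>The triple is nested as a pair and a number because
  \<open>nn_integral_power4_le_triple_product\<close> slices along the last coordinate.\<close>

lemma lborel_vec3:
  fixes i j k :: "'d::finite"
  assumes ij: "i \<noteq> j" "i \<noteq> k" "j \<noteq> k" "UNIV = {i, j, k}"
  shows "(lborel :: (real^'d) measure) = distr lborel borel (\<lambda>((s, t), z). s *\<^sub>R axis i 1 + t *\<^sub>R axis j 1 + z *\<^sub>R axis k 1)"
proof (rule lborel_eqI)
  let ?T = "\<lambda>((s, t), z). s *\<^sub>R axis i 1 + t *\<^sub>R axis j 1 + z *\<^sub>R axis k (1::real)"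
  have m: "?T \<in> borel_measurable borel"
    by (intro borel_measurable_continuous_onI) (auto simp: case_prod_unfold intro!: continuous_intros)
  fix l u :: "real^'d" assume le: "\<And>b. b \<in> Basis \<Longrightarrow> l \<bullet> b \<le> u \<bullet> b"
  have "l $ k \<le> u $ k" for k using le[of "axis k 1"] by (simp add: inner_axis axis_in_Basis_iff)
  then have lek: "l $ i \<le> u $ i" "l $ j \<le> u $ j" "l $ k \<le> u $ k" by auto
  have all: "(\<forall>m. P m) \<longleftrightarrow> P i \<and> P j \<and> P k" for P using ij(4) by (metis UNIV_I empty_iff insertE)
  have "?T -` box l u = ({l$i<..<u$i} \<times> {l$j<..<u$j}) \<times> {l$k<..<u$k}"
    using ij(1-3) by (auto simp: mem_box_cart all axis_def)
  then have "emeasure (distr lborel borel ?T) (box l u) = emeasure (lborel \<Otimes>\<^sub>M lborel) (({l$i<..<u$i} \<times> {l$j<..<u$j}) \<times> {l$k<..<u$k})"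
    using m by (simp add: emeasure_distr lborel_prod)
  also have "\<dots> = emeasure (lborel \<Otimes>\<^sub>M lborel) ({l$i<..<u$i} \<times> {l$j<..<u$j}) * emeasure lborel {l$k<..<u$k}"
    by (subst lborel.emeasure_pair_measure_Times) (simp_all add: lborel_prod borel_open open_Times)
  also have "\<dots> = ennreal ((u$i - l$i) * (u$j - l$j) * (u$k - l$k))"
    using lek by (subst lborel.emeasure_pair_measure_Times) (auto simp: ennreal_mult)
  also have "(u$i - l$i) * (u$j - l$j) * (u$k - l$k) = (\<Prod>k\<in>UNIV. u $ k - l $ k)"
    unfolding ij(4) using ij(1-3) by (simp add: mult.assoc)
  also have "\<dots> = (\<Prod>b\<in>Basis. (u - l) \<bullet> b)"
    by (simp add: Basis_vec_def UNION_singleton_eq_range prod.reindex inj_on_def axis_eq_axis inner_axis)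
  finally show "emeasure (distr lborel borel ?T) (box l u) = (\<Prod>b\<in>Basis. (u - l) \<bullet> b)" .
qed simp

text \<open>The fundamental theorem of calculus for the square of \<open>\<phi>\<close> along a
  coordinate line, started outside the support.\<close>

lemma test_fun_square_le_line_integral:
  fixes \<phi> :: "real^'d \<Rightarrow> real"
  assumes \<phi>: "test_fun \<Omega> \<phi>"
  shows "ennreal ((\<phi> (y + t *\<^sub>R axis j 1))\<^sup>2) \<le>
    (\<integral>\<^sup>+ s. ennreal (2 * \<bar>\<phi> (y + s *\<^sub>R axis j 1) * partial j \<phi> (y + s *\<^sub>R axis j 1)\<bar>) \<partial>lborel)"
proof -
  let ?g = "\<lambda>s. \<phi> (y + s *\<^sub>R axis j 1)" and ?g' = "\<lambda>s. partial j \<phi> (y + s *\<^sub>R axis j 1)"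
  obtain R where R: "R > 0" "\<And>x. \<phi> x \<noteq> 0 \<Longrightarrow> norm x \<le> R" using test_fun_support_cball[OF \<phi>] by blast
  \<comment> \<open>A starting point not beyond \<open>t\<close> and so far out that
    \<open>y + a *\<^sub>R axis j 1\<close> has left the ball containing the support.\<close>
  define a where "a = min t (- (R + norm y + 1))"
  have "norm (a *\<^sub>R axis j (1::real)) \<le> norm (y + a *\<^sub>R axis j 1) + norm y"
    by (metis add_diff_cancel_left' norm_triangle_ineq4 add.commute)
  then have "norm (y + a *\<^sub>R axis j 1) > R" using R(1) by (auto simp: a_def)
  then have ga: "?g a = 0" using R(2) by fastforce
  have cont: "continuous_on A (\<lambda>s. \<psi> (y + s *\<^sub>R axis j 1))" if "test_fun \<Omega> \<psi>" for A \<psi>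
    by (rule continuous_on_compose2[OF smooth_continuous_on[OF test_fun_smooth[OF that], of UNIV]])
      (auto intro!: continuous_intros)
  have c: "continuous_on {a..t} (\<lambda>s. 2 * (?g s * ?g' s))"
    by (intro continuous_intros cont \<phi> test_fun_partial)
  have der: "((\<lambda>s. (?g s)\<^sup>2) has_real_derivative 2 * (?g s * ?g' s)) (at s)" for s
    using line_has_derivative[OF test_fun_differentiable[OF \<phi>], where x=y and t=s and j=j]
    by (auto intro!: derivative_eq_intros)
  have int: "set_integrable lborel {a..t} (\<lambda>s. 2 * (?g s * ?g' s))"
    by (rule borel_integrable_atLeastAtMost'[OF c])
  have "(LBINT s. indicator {a..t} s *\<^sub>R (2 * (?g s * ?g' s))) = (?g t)\<^sup>2 - (?g a)\<^sup>2"
    by (rule integral_FTC_Icc)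
      (use c in \<open>auto simp: a_def intro!: has_vector_derivative_at_within der[THEN has_real_derivative_iff_has_vector_derivative[THEN iffD1]]\<close>)
  then have "(?g t)\<^sup>2 = (LINT s:{a..t}|lborel. 2 * (?g s * ?g' s))" 
    using ga unfolding set_lebesgue_integral_def by (simp only:) simp
  also have "\<dots> \<le> (LINT s:{a..t}|lborel. \<bar>2 * (?g s * ?g' s)\<bar>)"
    by (rule set_integral_mono[OF int set_integrable_abs[OF int]]) auto
  finally have "ennreal ((?g t)\<^sup>2) \<le> ennreal (LINT s:{a..t}|lborel. \<bar>2 * (?g s * ?g' s)\<bar>)" by (rule ennreal_leI)
  also have "\<dots> = (\<integral>\<^sup>+ s. ennreal (indicator {a..t} s *\<^sub>R \<bar>2 * (?g s * ?g' s)\<bar>) \<partial>lborel)"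
    unfolding set_lebesgue_integral_def
    by (rule nn_integral_eq_integral[symmetric])
      (use set_integrable_abs[OF int] in \<open>auto simp: set_integrable_def\<close>)
  also have "\<dots> \<le> (\<integral>\<^sup>+ s. ennreal (2 * \<bar>?g s * ?g' s\<bar>) \<partial>lborel)"
    by (intro nn_integral_mono ennreal_leI) (auto simp: abs_mult split: split_indicator)
  finally show ?thesis .
qed

text \<open>An inequality of Ladyzhenskaya type. The whole H1 energy stands on the right so that
  both dimensions share one statement.\<close>

lemma test_fun_L4_bound:
  fixes \<phi> :: "real^'d \<Rightarrow> real"
  assumes dim: "CARD('d) = 2 \<or> CARD('d) = 3" and \<phi>: "test_fun \<Omega> \<phi>"
  shows "(\<integral>\<^sup>+ x. ennreal ((\<phi> x)^4) \<partial>lborel) \<le>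
     4 * (\<integral>\<^sup>+ x. ennreal ((\<phi> x)\<^sup>2 + (\<Sum>j\<in>UNIV. (partial j \<phi> x)\<^sup>2)) \<partial>lborel)\<^sup>2"
proof -
  let ?E = "\<integral>\<^sup>+ x. ennreal ((\<phi> x)\<^sup>2 + (\<Sum>j\<in>UNIV. (partial j \<phi> x)\<^sup>2)) \<partial>lborel"
  let ?q = "\<lambda>j. \<integral>\<^sup>+ x. ennreal (2 * \<bar>\<phi> x * partial j \<phi> x\<bar>) \<partial>lborel"
  have [measurable]: "\<phi> \<in> borel_measurable borel" "partial j \<phi> \<in> borel_measurable borel" for j
    using \<phi> test_fun_borel test_fun_partial by blast+
  note line = test_fun_square_le_line_integral[OF \<phi>]
  \<comment> \<open>Young's inequality dominates each line integrand by the energy density.\<close>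
  have q: "?q j \<le> ?E" for j
  proof (intro nn_integral_mono ennreal_leI)
    fix x
    have "2 * \<bar>\<phi> x * partial j \<phi> x\<bar> \<le> (\<phi> x)\<^sup>2 + (partial j \<phi> x)\<^sup>2"
      using sum_squares_bound[of "\<bar>\<phi> x\<bar>" "\<bar>partial j \<phi> x\<bar>"] by (simp add: abs_mult)
    also have "(partial j \<phi> x)\<^sup>2 \<le> (\<Sum>j\<in>UNIV. (partial j \<phi> x)\<^sup>2)" by (rule member_le_sum) auto
    finally show "2 * \<bar>\<phi> x * partial j \<phi> x\<bar> \<le> (\<phi> x)\<^sup>2 + (\<Sum>j\<in>UNIV. (partial j \<phi> x)\<^sup>2)" by simp
  qed
  from dim show ?thesis
  proof
    assume "CARD('d) = 2"
    then obtain i j :: 'd where ij: "UNIV = {i, j}" "i \<noteq> j" by (auto simp: card_2_iff)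
    let ?T = "\<lambda>(s, t). s *\<^sub>R axis i 1 + t *\<^sub>R axis j (1::real)"
    have [measurable]: "?T \<in> borel_measurable borel"
      by (intro borel_measurable_continuous_onI) (auto simp: case_prod_unfold intro!: continuous_intros)
    have tr: "(\<integral>\<^sup>+ x. h x \<partial>lborel) = (\<integral>\<^sup>+ w. h (?T w) \<partial>(lborel \<Otimes>\<^sub>M lborel))"
      if "h \<in> borel_measurable borel" for h :: "real^'d \<Rightarrow> ennreal"
      using that unfolding lborel_prod by (subst lborel_vec2[OF ij(2,1)], subst nn_integral_distr) auto
    have "(\<integral>\<^sup>+ x. ennreal ((\<phi> x)^4) \<partial>lborel) = (\<integral>\<^sup>+ w. (ennreal ((\<phi> (?T w))\<^sup>2))\<^sup>2 \<partial>(lborel \<Otimes>\<^sub>M lborel))"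
      by (subst tr) (simp_all add: ennreal_power)
    also have "\<dots> \<le> (\<integral>\<^sup>+ w. ennreal (2 * \<bar>\<phi> (?T w) * partial i \<phi> (?T w)\<bar>) \<partial>(lborel \<Otimes>\<^sub>M lborel)) *
        (\<integral>\<^sup>+ w. ennreal (2 * \<bar>\<phi> (?T w) * partial j \<phi> (?T w)\<bar>) \<partial>(lborel \<Otimes>\<^sub>M lborel))"
    proof (rule nn_integral_square_le_product)
      show "ennreal ((\<phi> (?T (s, t)))\<^sup>2) \<le> (\<integral>\<^sup>+ s'. ennreal (2 * \<bar>\<phi> (?T (s', t)) * partial i \<phi> (?T (s', t))\<bar>) \<partial>lborel)" for s t
        using line[of "t *\<^sub>R axis j 1" s i] by (simp add: add.commute)
      show "ennreal ((\<phi> (?T (s, t)))\<^sup>2) \<le> (\<integral>\<^sup>+ t'. ennreal (2 * \<bar>\<phi> (?T (s, t')) * partial j \<phi> (?T (s, t'))\<bar>) \<partial>lborel)" for s t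
        using line[of "s *\<^sub>R axis i 1" t j] by simp
    qed (auto simp: lborel.sigma_finite_measure_axioms lborel_prod)
    also have "\<dots> = ?q i * ?q j" by (simp add: tr)
    also have "\<dots> \<le> ?E * ?E" by (intro mult_mono q) auto
    \<comment> \<open>The factor 4 serves to match the constant of the three-dimensional
      case.\<close>
    also have "\<dots> \<le> 4 * (?E * ?E)"
      using mult_right_mono[of 1 4 "?E * ?E"] by simp
    finally show ?thesis by (simp add: power2_eq_square)
  next
    assume "CARD('d) = 3"
    then obtain i j k :: 'd where ij: "UNIV = {i, j, k}" "i \<noteq> j" "i \<noteq> k" "j \<noteq> k" by (auto simp: card_3_iff)
    let ?T = "\<lambda>((s, t), z). s *\<^sub>R axis i 1 + t *\<^sub>R axis j 1 + z *\<^sub>R axis k (1::real)"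
    have [measurable]: "?T \<in> borel_measurable borel"
      by (intro borel_measurable_continuous_onI) (auto simp: case_prod_unfold intro!: continuous_intros)
    have tr: "(\<integral>\<^sup>+ x. h x \<partial>lborel) = (\<integral>\<^sup>+ w. h (?T w) \<partial>lborel)"
      if "h \<in> borel_measurable borel" for h :: "real^'d \<Rightarrow> ennreal"
      using that by (subst lborel_vec3[OF ij(2,3,4,1)], subst nn_integral_distr) auto
    have "(\<integral>\<^sup>+ x. ennreal ((\<phi> x)^4) \<partial>lborel) = (\<integral>\<^sup>+ w. ennreal ((\<phi> (?T w))^4) \<partial>lborel)"
      by (subst tr) simp_all
    also have "\<dots> \<le> 4 * (\<integral>\<^sup>+ w. ennreal (2 * \<bar>\<phi> (?T w) * partial k \<phi> (?T w)\<bar>) \<partial>lborel)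
       * ((\<integral>\<^sup>+ w. ennreal ((partial i \<phi> (?T w))\<^sup>2) \<partial>lborel) + (\<integral>\<^sup>+ w. ennreal ((partial j \<phi> (?T w))\<^sup>2) \<partial>lborel))"
    proof (rule nn_integral_power4_le_triple_product)
      fix s t z
      show "ennreal ((\<phi> (?T ((s, t), z)))\<^sup>2) \<le> (\<integral>\<^sup>+ s'. ennreal (2 * \<bar>\<phi> (?T ((s', t), z)) * partial i \<phi> (?T ((s', t), z))\<bar>) \<partial>lborel)"
        using line[of "t *\<^sub>R axis j 1 + z *\<^sub>R axis k 1" s i] by (simp add: ac_simps)
      show "ennreal ((\<phi> (?T ((s, t), z)))\<^sup>2) \<le> (\<integral>\<^sup>+ t'. ennreal (2 * \<bar>\<phi> (?T ((s, t'), z)) * partial j \<phi> (?T ((s, t'), z))\<bar>) \<partial>lborel)"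
        using line[of "s *\<^sub>R axis i 1 + z *\<^sub>R axis k 1" t j] by (simp add: ac_simps)
      show "ennreal ((\<phi> (?T ((s, t), z)))\<^sup>2) \<le> (\<integral>\<^sup>+ z'. ennreal (2 * \<bar>\<phi> (?T ((s, t), z')) * partial k \<phi> (?T ((s, t), z'))\<bar>) \<partial>lborel)"
        using line[of "s *\<^sub>R axis i 1 + t *\<^sub>R axis j 1" z k] by (simp add: ac_simps)
    qed auto
    also have "\<dots> = 4 * ?q k * ((\<integral>\<^sup>+ x. ennreal ((partial i \<phi> x)\<^sup>2) \<partial>lborel) + (\<integral>\<^sup>+ x. ennreal ((partial j \<phi> x)\<^sup>2) \<partial>lborel))"
      by (simp add: tr)
    also have "\<dots> = 4 * ?q k * (\<integral>\<^sup>+ x. ennreal ((partial i \<phi> x)\<^sup>2 + (partial j \<phi> x)\<^sup>2) \<partial>lborel)"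
      by (simp add: nn_integral_add)
    also have "\<dots> \<le> 4 * ?E * ?E"
    proof (intro mult_mono mult_left_mono q)
      show "(\<integral>\<^sup>+ x. ennreal ((partial i \<phi> x)\<^sup>2 + (partial j \<phi> x)\<^sup>2) \<partial>lborel) \<le> ?E"
        using ij(2-4) by (intro nn_integral_mono ennreal_leI) (simp add: ij(1))
    qed auto
    finally show ?thesis by (simp add: power2_eq_square mult.assoc)
  qed
qed

section \<open>The convective form\<close>


text \<open>The bridge from classical derivatives integrated over the whole space, as in
  \<open>test_fun_L4_bound\<close>, to the norms on \<open>\<Omega>\<close> of the chosen weak
  gradient.\<close>

lemma test_field_component_energy_le:
  fixes \<phi> :: "real^'d \<Rightarrow> real^'d"
  assumes op: "open \<Omega>" and \<Omega>: "\<Omega> \<in> lmeasurable" and \<phi>: "test_field \<Omega> \<phi>"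
  shows "(\<integral>\<^sup>+ x. ennreal ((\<phi> x $ i)\<^sup>2 + (\<Sum>j\<in>UNIV. (partial j (\<lambda>x. \<phi> x $ i) x)\<^sup>2)) \<partial>lborel)
    \<le> ennreal ((l2norm \<Omega> \<phi>)\<^sup>2 + (gnorm \<Omega> \<phi>)\<^sup>2)"
proof -
  have s: "\<Omega> \<in> sets lebesgue" using \<Omega> by auto
  let ?h = "\<lambda>x. (\<phi> x $ i)\<^sup>2 + (\<Sum>j\<in>UNIV. (partial j (\<lambda>x. \<phi> x $ i) x)\<^sup>2)"
  have t: "test_fun \<Omega> (\<lambda>x. \<phi> x $ i)" using \<phi> by (simp add: test_field_def)
  note H = test_field_grad[OF op \<Omega> \<phi>]
  have L: "L2 \<Omega> \<phi>" "L2 \<Omega> (grad \<Omega> \<phi>)" using H(1) H1_grad by (auto simp: H1_def)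
  have ae: "AE x in lebesgue_on \<Omega>. grad \<Omega> \<phi> x = (\<chi> i j. partial j (\<lambda>x. \<phi> x $ i) x)"
    using H(2) by (simp add: ae_eq_on_iff[OF s])
  have "(\<integral>\<^sup>+ x. ennreal (?h x) \<partial>lborel) = (\<integral>\<^sup>+ x. ennreal (?h x) * indicator \<Omega> x \<partial>lebesgue)"
    unfolding nn_integral_completion
    by (intro nn_integral_cong)
      (use test_fun_zero_outside[OF t] test_fun_zero_outside[OF test_fun_partial[OF t]] in \<open>auto split: split_indicator\<close>)
  also have "\<dots> = (\<integral>\<^sup>+ x. ennreal (?h x) \<partial>lebesgue_on \<Omega>)"
    using s by (simp add: nn_integral_restrict_space)
  also have "\<dots> \<le> (\<integral>\<^sup>+ x. ennreal ((norm (\<phi> x))\<^sup>2 + (norm (grad \<Omega> \<phi> x))\<^sup>2) \<partial>lebesgue_on \<Omega>)"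
  proof (rule nn_integral_mono_AE, use ae in eventually_elim)
    fix x assume g: "grad \<Omega> \<phi> x = (\<chi> i j. partial j (\<lambda>x. \<phi> x $ i) x)"
    have "(\<Sum>j\<in>UNIV. (partial j (\<lambda>x. \<phi> x $ i) x)\<^sup>2) = (norm (grad \<Omega> \<phi> x $ i))\<^sup>2"
      by (simp add: g norm_vec_def L2_set_def sum_nonneg)
    also have "\<dots> \<le> (norm (grad \<Omega> \<phi> x))\<^sup>2"
      by (intro power_mono Finite_Cartesian_Product.norm_nth_le) auto
    finally have "(\<Sum>j\<in>UNIV. (partial j (\<lambda>x. \<phi> x $ i) x)\<^sup>2) \<le> (norm (grad \<Omega> \<phi> x))\<^sup>2" .
    moreover have "(\<phi> x $ i)\<^sup>2 \<le> (norm (\<phi> x))\<^sup>2"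
      using power_mono[OF Finite_Cartesian_Product.norm_nth_le[of "\<phi> x" i], of 2] by simp
    ultimately show "ennreal (?h x) \<le> ennreal ((norm (\<phi> x))\<^sup>2 + (norm (grad \<Omega> \<phi> x))\<^sup>2)"
      by (intro ennreal_leI add_mono)
  qed
  also have "\<dots> = ennreal (LINT x|lebesgue_on \<Omega>. (norm (\<phi> x))\<^sup>2 + (norm (grad \<Omega> \<phi> x))\<^sup>2)"
    using L by (intro nn_integral_eq_integral) (auto simp: L2_iff[OF s])
  also have "(LINT x|lebesgue_on \<Omega>. (norm (\<phi> x))\<^sup>2 + (norm (grad \<Omega> \<phi> x))\<^sup>2) = (l2norm \<Omega> \<phi>)\<^sup>2 + (gnorm \<Omega> \<phi>)\<^sup>2"
    using L by (simp add: L2_iff[OF s] gnorm_def l2norm_eq[OF s] Bochner_Integration.integral_nonneg)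
  finally show ?thesis .
qed

text \<open>The approximating test fields are bounded in H1, so their components are bounded in L4.
  Convergence in L2 gives a subsequence converging almost everywhere, along which Fatou's lemma
  carries the bound to the limit.\<close>

lemma Xsp_component_L4:
  fixes v :: "real^'d \<Rightarrow> real^'d"
  assumes dim: "CARD('d) = 2 \<or> CARD('d) = 3"
    and op: "open \<Omega>" and \<Omega>: "\<Omega> \<in> lmeasurable" and v: "v \<in> Xsp \<Omega>"
  shows "integrable (lebesgue_on \<Omega>) (\<lambda>x. (v x $ i)^4)"
proof -
  have s: "\<Omega> \<in> sets lebesgue" using \<Omega> by auto
  obtain \<phi> where \<phi>: "\<And>n. test_field \<Omega> (\<phi> n)"
    and lim: "(\<lambda>n. l2norm \<Omega> (\<lambda>x. \<phi> n x - v x) + l2norm \<Omega> (\<lambda>x. grad \<Omega> (\<phi> n) x - grad \<Omega> v x)) \<longlonglongrightarrow> 0"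
    using v unfolding Xsp_def by blast
  let ?a = "\<lambda>n. l2norm \<Omega> (\<lambda>x. \<phi> n x - v x)" and ?g = "\<lambda>n. l2norm \<Omega> (\<lambda>x. grad \<Omega> (\<phi> n) x - grad \<Omega> v x)"
  have L\<phi>: "L2 \<Omega> (\<phi> n)" "L2 \<Omega> (grad \<Omega> (\<phi> n))" for n
    using test_field_grad(1)[OF op \<Omega> \<phi>] H1_grad(1) by (auto simp: H1_def)
  have t: "test_fun \<Omega> (\<lambda>x. \<phi> n x $ i)" for n using \<phi> by (simp add: test_field_def)
  note Lv = Xsp_L2[OF v] Xsp_grad_L2[OF v]
  \<comment> \<open>A convergent sequence is bounded, which yields one \<open>B\<close> for the
    squared H1 norms of all approximants.\<close>
  obtain K where K: "\<And>n. \<bar>?a n + ?g n\<bar> \<le> K"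
    using convergent_imp_Bseq[OF convergentI[OF lim]] by (auto simp: Bseq_def)
  define B where "B = (l2norm \<Omega> v + K)\<^sup>2 + (gnorm \<Omega> v + K)\<^sup>2"
  have B: "(l2norm \<Omega> (\<phi> n))\<^sup>2 + (gnorm \<Omega> (\<phi> n))\<^sup>2 \<le> B" for n
  proof -
    have "?a n \<le> K" "?g n \<le> K" using K[of n] l2norm_nonneg[of \<Omega>] by (smt (verit))+
    moreover have "l2norm \<Omega> (\<phi> n) \<le> ?a n + l2norm \<Omega> v"
      using l2norm_lincomb_le[OF s L2_diff[OF s L\<phi>(1)[of n] Lv(1)] Lv(1), where a=1 and b=1] by simp
    moreover have "gnorm \<Omega> (\<phi> n) \<le> ?g n + gnorm \<Omega> v"
      using l2norm_lincomb_le[OF s L2_diff[OF s L\<phi>(2)[of n] Lv(2)] Lv(2), where a=1 and b=1] by (simp add: gnorm_def)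
    ultimately show ?thesis unfolding B_def
      by (intro add_mono power_mono) (auto simp: l2norm_nonneg gnorm_def)
  qed
  have bound: "(\<integral>\<^sup>+ x. ennreal ((\<phi> n x $ i)^4) \<partial>lebesgue_on \<Omega>) \<le> 4 * (ennreal B)\<^sup>2" for n
  proof -
    have "(\<integral>\<^sup>+ x. ennreal ((\<phi> n x $ i)^4) \<partial>lebesgue_on \<Omega>) \<le> (\<integral>\<^sup>+ x. ennreal ((\<phi> n x $ i)^4) \<partial>lebesgue)"
      using s by (simp add: nn_integral_restrict_space) (intro nn_integral_mono, auto split: split_indicator)
    also have "\<dots> = (\<integral>\<^sup>+ x. ennreal ((\<phi> n x $ i)^4) \<partial>lborel)" by (rule nn_integral_completion)
    also have "\<dots> \<le> 4 * (\<integral>\<^sup>+ x. ennreal ((\<phi> n x $ i)\<^sup>2 + (\<Sum>j\<in>UNIV. (partial j (\<lambda>x. \<phi> n x $ i) x)\<^sup>2)) \<partial>lborel)\<^sup>2"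
      by (rule test_fun_L4_bound[OF dim t])
    also have "\<dots> \<le> 4 * (ennreal B)\<^sup>2"
      by (intro mult_left_mono power_mono order_trans[OF test_field_component_energy_le[OF op \<Omega> \<phi>]] ennreal_leI B) auto
    finally show ?thesis .
  qed
  have "?a \<longlonglongrightarrow> 0"
    by (rule tendsto_sandwich[OF _ _ tendsto_const lim]) (auto simp: l2norm_nonneg)
  then have "(\<lambda>n. (?a n)\<^sup>2) \<longlonglongrightarrow> 0\<^sup>2" by (intro tendsto_power)
  then have "(\<lambda>n. LINT x|lebesgue_on \<Omega>. norm ((norm (\<phi> n x - v x))\<^sup>2)) \<longlonglongrightarrow> 0"
    by (simp add: l2norm_eq[OF s] Bochner_Integration.integral_nonneg)
  moreover have "integrable (lebesgue_on \<Omega>) (\<lambda>x. (norm (\<phi> n x - v x))\<^sup>2)" for n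
    using L2_diff[OF s L\<phi>(1) Lv(1)] by (simp add: L2_iff[OF s])
  ultimately obtain r :: "nat \<Rightarrow> nat"
    where r: "AE x in lebesgue_on \<Omega>. (\<lambda>n. (norm (\<phi> (r n) x - v x))\<^sup>2) \<longlonglongrightarrow> 0"
    using tendsto_L1_AE_subseq[of "lebesgue_on \<Omega>" "\<lambda>n x. (norm (\<phi> n x - v x))\<^sup>2"] by blast
  have [measurable]: "(\<lambda>x. \<phi> n x $ i) \<in> borel_measurable (lebesgue_on \<Omega>)" "(\<lambda>x. v x $ i) \<in> borel_measurable (lebesgue_on \<Omega>)" for n
    using L2_nth[OF s L\<phi>(1)] L2_nth[OF s Lv(1)] by (auto simp: L2_iff[OF s])
  have "(\<integral>\<^sup>+ x. ennreal ((v x $ i)^4) \<partial>lebesgue_on \<Omega>) \<le> (\<integral>\<^sup>+ x. liminf (\<lambda>n. ennreal ((\<phi> (r n) x $ i)^4)) \<partial>lebesgue_on \<Omega>)"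
  proof (rule nn_integral_mono_AE, use r in eventually_elim)
    fix x assume "(\<lambda>n. (norm (\<phi> (r n) x - v x))\<^sup>2) \<longlonglongrightarrow> 0"
    then have "(\<lambda>n. norm (\<phi> (r n) x - v x)) \<longlonglongrightarrow> 0"
      using tendsto_real_sqrt by fastforce
    then have "(\<lambda>n. \<phi> (r n) x) \<longlonglongrightarrow> v x" by (metis LIM_zero_cancel tendsto_norm_zero_cancel)
    then have "(\<lambda>n. ennreal ((\<phi> (r n) x $ i)^4)) \<longlonglongrightarrow> ennreal ((v x $ i)^4)"
      by (intro tendsto_ennrealI tendsto_power tendsto_vec_nth)
    then have "liminf (\<lambda>n. ennreal ((\<phi> (r n) x $ i)^4)) = ennreal ((v x $ i)^4)"
      by (rule lim_imp_Liminf[OF sequentially_bot])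
    then show "ennreal ((v x $ i)^4) \<le> liminf (\<lambda>n. ennreal ((\<phi> (r n) x $ i)^4))"
      by (simp only: order_refl)
  qed
  also have "\<dots> \<le> liminf (\<lambda>n. \<integral>\<^sup>+ x. ennreal ((\<phi> (r n) x $ i)^4) \<partial>lebesgue_on \<Omega>)"
    by (rule nn_integral_liminf) simp
  also have "\<dots> \<le> 4 * (ennreal B)\<^sup>2"
    by (rule Liminf_le) (auto simp: bound)
  also have "\<dots> < \<infinity>" by (simp add: power2_eq_square ennreal_mult_less_top)
  finally show ?thesis by (intro integrableI_bounded) auto
qed

text \<open>By (a b)^2 \<le> a^4 + b^4 this reduces to the integrability of fourth powers; it is how
  the dimension enters the convective form.\<close>

lemma Xsp_component_product_L2:
  fixes u v :: "real^'d \<Rightarrow> real^'d"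
  assumes "CARD('d) = 2 \<or> CARD('d) = 3" "open \<Omega>" and \<Omega>: "\<Omega> \<in> lmeasurable" and u: "u \<in> Xsp \<Omega>" and v: "v \<in> Xsp \<Omega>"
  shows "L2 \<Omega> (\<lambda>x. u x $ j * v x $ i)"
proof -
  have s: "\<Omega> \<in> sets lebesgue" using \<Omega> by auto
  have [measurable]: "(\<lambda>x. u x $ j) \<in> borel_measurable (lebesgue_on \<Omega>)" "(\<lambda>x. v x $ i) \<in> borel_measurable (lebesgue_on \<Omega>)"
    using L2_nth[OF s Xsp_L2[OF u]] L2_nth[OF s Xsp_L2[OF v]] by (auto simp: L2_iff[OF s])
  have *: "(a * b)\<^sup>2 \<le> a^4 + b^4" for a b :: real
  proof -
    have "2 * (a\<^sup>2 * b\<^sup>2) \<le> a^4 + b^4" using sum_squares_bound[of "a\<^sup>2" "b\<^sup>2"] by simp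
    moreover have "0 \<le> a\<^sup>2 * b\<^sup>2" by simp
    ultimately show ?thesis unfolding power_mult_distrib by linarith
  qed
  have "integrable (lebesgue_on \<Omega>) (\<lambda>x. (norm (u x $ j * v x $ i))\<^sup>2)"
    by (rule Bochner_Integration.integrable_bound[where f="\<lambda>x. (u x $ j)^4 + (v x $ i)^4"])
      (use assms * in \<open>auto intro!: Bochner_Integration.integrable_add Xsp_component_L4 AE_I2\<close>)
  then show ?thesis by (simp add: L2_iff[OF s])
qed

lemma matrix_vector_inner_eq_sum:
  fixes A :: "real^'n^'n"
  shows "(A *v a) \<bullet> b = (\<Sum>i\<in>UNIV. \<Sum>j\<in>UNIV. A $ i $ j * (a $ j * b $ i))"
  by (simp add: inner_vec_def matrix_vector_mult_def sum_distrib_right mult.assoc)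

text \<open>Entrywise the integrand is a product of two L2 functions, an entry of \<open>G\<close>
  and \<open>u x $ j * v x $ i\<close>. \<open>G\<close> is an arbitrary square integrable field so
  that it can be any almost everywhere representative of a gradient.\<close>

lemma convection_integrable:
  fixes u v :: "real^'d \<Rightarrow> real^'d"
  assumes dim: "CARD('d) = 2 \<or> CARD('d) = 3" and op: "open \<Omega>" and \<Omega>: "\<Omega> \<in> lmeasurable"
    and G: "L2 \<Omega> G" and u: "u \<in> Xsp \<Omega>" and v: "v \<in> Xsp \<Omega>"
  shows "integrable (lebesgue_on \<Omega>) (\<lambda>x. (G x *v u x) \<bullet> v x)"
proof -
  have s: "\<Omega> \<in> sets lebesgue" using \<Omega> by auto
  show ?thesis unfolding matrix_vector_inner_eq_sum
    using L2_inner_integrable[OF s L2_nth[OF s L2_nth[OF s G]] Xsp_component_product_L2[OF dim op \<Omega> u v]] by simp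
qed

lemma bform_cong_grad:
  fixes u w v :: "real^'d \<Rightarrow> real^'d"
  assumes dim: "CARD('d) = 2 \<or> CARD('d) = 3" and op: "open \<Omega>" and \<Omega>: "\<Omega> \<in> lmeasurable"
    and G: "L2 \<Omega> G" "L2 \<Omega> (grad \<Omega> w)" "ae_eq_on \<Omega> (grad \<Omega> w) G" and u: "u \<in> Xsp \<Omega>" and v: "v \<in> Xsp \<Omega>"
  shows "bform \<Omega> u w v = (LINT x|lebesgue_on \<Omega>. (G x *v u x) \<bullet> v x)"
proof -
  have s: "\<Omega> \<in> sets lebesgue" using \<Omega> by auto
  show ?thesis unfolding bform_def LINT_lebesgue_on[OF s]
  proof (rule integral_cong_AE)
    show "AE x in lebesgue_on \<Omega>. (grad \<Omega> w x *v u x) \<bullet> v x = (G x *v u x) \<bullet> v x"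
      using G(3) unfolding ae_eq_on_iff[OF s] by eventually_elim simp
  qed (use convection_integrable[OF dim op \<Omega>] G u v in blast)+
qed

text \<open>Linearity is pointwise in the first and third arguments, but holds only almost
  everywhere in the second, through \<open>grad_lincomb\<close>. Integrability of each term is what
  permits splitting the integrals.\<close>

lemma bform_lincomb:
  fixes u u' w w' v v' :: "real^'d \<Rightarrow> real^'d"
  assumes dim: "CARD('d) = 2 \<or> CARD('d) = 3" and op: "open \<Omega>" and \<Omega>: "\<Omega> \<in> lmeasurable"
    and u: "u \<in> Xsp \<Omega>" and w: "w \<in> Xsp \<Omega>" and v: "v \<in> Xsp \<Omega>"
  shows bform_lincomb1: "u' \<in> Xsp \<Omega> \<Longrightarrow> bform \<Omega> (\<lambda>x. a *\<^sub>R u x + b *\<^sub>R u' x) w v = a * bform \<Omega> u w v + b * bform \<Omega> u' w v"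
    and bform_lincomb2: "w' \<in> Xsp \<Omega> \<Longrightarrow> bform \<Omega> u (\<lambda>x. a *\<^sub>R w x + b *\<^sub>R w' x) v = a * bform \<Omega> u w v + b * bform \<Omega> u w' v"
    and bform_lincomb3: "v' \<in> Xsp \<Omega> \<Longrightarrow> bform \<Omega> u w (\<lambda>x. a *\<^sub>R v x + b *\<^sub>R v' x) = a * bform \<Omega> u w v + b * bform \<Omega> u w v'"
proof -
  have s: "\<Omega> \<in> sets lebesgue" using \<Omega> by auto
  note int = convection_integrable[OF dim op \<Omega> Xsp_grad_L2]
  show "bform \<Omega> (\<lambda>x. a *\<^sub>R u x + b *\<^sub>R u' x) w v = a * bform \<Omega> u w v + b * bform \<Omega> u' w v" if u': "u' \<in> Xsp \<Omega>"
    unfolding bform_def LINT_lebesgue_on[OF s] using int[OF w u v] int[OF w u' v]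
    by (simp add: matrix_vector_right_distrib matrix_vector_mult_scaleR inner_add_left)
  show "bform \<Omega> u w (\<lambda>x. a *\<^sub>R v x + b *\<^sub>R v' x) = a * bform \<Omega> u w v + b * bform \<Omega> u w v'" if v': "v' \<in> Xsp \<Omega>"
    unfolding bform_def LINT_lebesgue_on[OF s] using int[OF w u v] int[OF w u v']
    by (simp add: inner_add_right)
  show "bform \<Omega> u (\<lambda>x. a *\<^sub>R w x + b *\<^sub>R w' x) v = a * bform \<Omega> u w v + b * bform \<Omega> u w' v" if w': "w' \<in> Xsp \<Omega>"
  proof -
    have "bform \<Omega> u (\<lambda>x. a *\<^sub>R w x + b *\<^sub>R w' x) v = (LINT x|lebesgue_on \<Omega>. ((a *\<^sub>R grad \<Omega> w x + b *\<^sub>R grad \<Omega> w' x) *v u x) \<bullet> v x)"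
      by (intro bform_cong_grad dim op \<Omega> L2_lincomb s Xsp_grad_L2 Xsp_lincomb u v w w' grad_lincomb Xsp_H1)
    also have "\<dots> = (LINT x|lebesgue_on \<Omega>. a * ((grad \<Omega> w x *v u x) \<bullet> v x) + b * ((grad \<Omega> w' x *v u x) \<bullet> v x))"
      by (simp add: matrix_vector_mult_add_rdistrib inner_add_left scaleR_matrix_vector_assoc[symmetric])
    finally show ?thesis
      unfolding bform_def LINT_lebesgue_on[OF s] using int[OF w u v] int[OF w' u v] by simp
  qed
qed

text \<open>Twice the integrand is, almost everywhere, the sum over i of w . grad(\<phi>_i^2), and
  \<phi>_i^2 is a test function. The weak gradient of \<open>w\<close> turns the integral into minus
  that of div w times \<phi>_i^2, summed over i, which is 0.\<close>

lemma bform_test_field_zero: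
  fixes w \<phi> :: "real^'d \<Rightarrow> real^'d"
  assumes dim: "CARD('d) = 2 \<or> CARD('d) = 3" and op: "open \<Omega>" and \<Omega>: "\<Omega> \<in> lmeasurable"
    and w: "w \<in> Vsp \<Omega>" and \<phi>: "test_field \<Omega> \<phi>"
  shows "bform \<Omega> w \<phi> \<phi> = 0"
proof -
  have s: "\<Omega> \<in> sets lebesgue" using \<Omega> by auto
  have wX: "w \<in> Xsp \<Omega>" using w by (simp add: Vsp_def)
  have div: "AE x in lebesgue_on \<Omega>. trace (grad \<Omega> w x) = 0"
    using w s by (simp add: Vsp_def AE_restrict_space_iff)
  define \<psi> where "\<psi> i x = \<phi> x $ i * \<phi> x $ i" for i x
  have t: "test_fun \<Omega> (\<lambda>x. \<phi> x $ i)" for i using \<phi> by (simp add: test_field_def)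
  have \<psi>: "test_fun \<Omega> (\<psi> i)" for i unfolding \<psi>_def by (intro test_fun_mult t test_fun_smooth[OF t])
  have p\<psi>: "partial j (\<psi> i) x = 2 * (partial j (\<lambda>x. \<phi> x $ i) x * \<phi> x $ i)" for i j x
    unfolding \<psi>_def[abs_def] by (subst partial_mult) (auto intro: test_fun_differentiable t)
  have int: "integrable (lebesgue_on \<Omega>) (\<lambda>x. f x * g x)" if "L2 \<Omega> f" "L2 \<Omega> g" for f g :: "real^'d \<Rightarrow> real"
    using L2_inner_integrable[OF s that] by simp
  have i1: "integrable (lebesgue_on \<Omega>) (\<lambda>x. w x $ j * partial j (\<psi> i) x)" for i j
    by (intro int L2_nth s Xsp_L2 wX test_fun_L2 test_fun_partial \<psi>)
  have i2: "integrable (lebesgue_on \<Omega>) (\<lambda>x. grad \<Omega> w x $ j $ j * \<psi> i x)" for i j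
    by (intro int L2_nth s Xsp_grad_L2 wX test_fun_L2 \<psi>)
  have zero: "(\<Sum>j\<in>UNIV. LINT x|lebesgue_on \<Omega>. w x $ j * partial j (\<psi> i) x) = 0" for i
  proof -
    have "(\<Sum>j\<in>UNIV. LINT x|lebesgue_on \<Omega>. w x $ j * partial j (\<psi> i) x)
        = (\<Sum>j\<in>UNIV. - (LINT x|lebesgue_on \<Omega>. grad \<Omega> w x $ j $ j * \<psi> i x))"
      using H1_grad(2)[OF Xsp_H1[OF wX]] \<psi> by (simp add: is_weak_grad_def LINT_lebesgue_on[OF s])
    also have "\<dots> = - (LINT x|lebesgue_on \<Omega>. trace (grad \<Omega> w x) * \<psi> i x)"
      using i2 by (simp add: trace_def sum_distrib_right sum_negf)
    also have "(LINT x|lebesgue_on \<Omega>. trace (grad \<Omega> w x) * \<psi> i x) = 0"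
      by (rule integral_eq_zero_AE, use div in eventually_elim) simp
    finally show ?thesis by simp
  qed
  have "2 * bform \<Omega> w \<phi> \<phi> = 2 * (LINT x|lebesgue_on \<Omega>. ((\<chi> i j. partial j (\<lambda>x. \<phi> x $ i) x) *v w x) \<bullet> \<phi> x)"
    by (subst bform_cong_grad[OF dim op \<Omega> _ _ test_field_grad(2)[OF op \<Omega> \<phi>] wX test_field_in_Xsp[OF op \<Omega> \<phi>]])
      (auto intro!: L2_vecI s test_fun_L2 test_fun_partial t H1_grad(1) test_field_grad(1)[OF op \<Omega> \<phi>])
  also have "\<dots> = (LINT x|lebesgue_on \<Omega>. (\<Sum>i\<in>UNIV. \<Sum>j\<in>UNIV. w x $ j * partial j (\<psi> i) x))"
    by (simp add: matrix_vector_inner_eq_sum p\<psi> sum_distrib_left mult_ac flip: integral_mult_right_zero)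
  also have "\<dots> = 0" using i1 zero by simp
  finally show ?thesis by simp
qed

section \<open>Two-sided bounds and cancellation for b\<close>

lemma gnorm_nonneg: "0 \<le> gnorm \<Omega> u"
  by (simp add: gnorm_def l2norm_nonneg)

lemma gnorm_lincomb:
  assumes op: "open \<Omega>" and \<Omega>: "\<Omega> \<in> lmeasurable" and u: "u \<in> Xsp \<Omega>" and v: "v \<in> Xsp \<Omega>"
  shows "gnorm \<Omega> (\<lambda>x. a *\<^sub>R u x + b *\<^sub>R v x) = l2norm \<Omega> (\<lambda>x. a *\<^sub>R grad \<Omega> u x + b *\<^sub>R grad \<Omega> v x)"
proof -
  have s: "\<Omega> \<in> sets lebesgue" using \<Omega> by auto
  show ?thesis unfolding gnorm_def
    by (intro l2norm_cong_ae grad_lincomb L2_lincomb s Xsp_grad_L2 Xsp_lincomb op \<Omega> Xsp_H1 u v)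
qed

text \<open>The given bounds on b carry no absolute value; applying them to -v supplies the other
  side. \<open>K\<close> collects the factors of the two frozen arguments.\<close>

lemma abs_bform_le:
  fixes a w v :: "real^'d \<Rightarrow> real^'d"
  assumes dim: "CARD('d) = 2 \<or> CARD('d) = 3" and op: "open \<Omega>" and \<Omega>: "\<Omega> \<in> lmeasurable"
    and bnd: "\<And>v. v \<in> Xsp \<Omega> \<Longrightarrow> bform \<Omega> a w v \<le> K * gnorm \<Omega> v"
    and X: "a \<in> Xsp \<Omega>" "w \<in> Xsp \<Omega>" "v \<in> Xsp \<Omega>"
  shows "\<bar>bform \<Omega> a w v\<bar> \<le> K * gnorm \<Omega> v"
proof -
  let ?v = "\<lambda>x. (-1) *\<^sub>R v x + 0 *\<^sub>R v x"
  have "bform \<Omega> a w ?v = - bform \<Omega> a w v"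
    using bform_lincomb3[OF dim op \<Omega> X X(3), of "-1" 0] by simp
  moreover have "gnorm \<Omega> ?v = gnorm \<Omega> v"
    using gnorm_lincomb[OF op \<Omega> X(3,3), of "-1" 0] by (simp add: gnorm_def l2norm_def)
  moreover have "bform \<Omega> a w ?v \<le> K * gnorm \<Omega> ?v" by (intro bnd Xsp_lincomb op \<Omega> X)
  ultimately show ?thesis using bnd[OF X(3)] by (simp add: abs_le_iff)
qed

text \<open>Density: expanding b(w, \<phi>_n, \<phi>_n) = 0 around \<open>v\<close> leaves b(w,v,v)
  plus terms that each contain \<open>\<delta> n\<close>, the difference of \<phi>_n and
  \<open>v\<close>. The bound with \<open>M\<close> makes b continuous for \<open>gnorm\<close>, so
  these terms tend to 0.\<close>

lemma bform_self_zero: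
  fixes w v :: "real^'d \<Rightarrow> real^'d"
  assumes dim: "CARD('d) = 2 \<or> CARD('d) = 3" and op: "open \<Omega>" and \<Omega>: "\<Omega> \<in> lmeasurable"
    and bnd: "\<forall>a\<in>Xsp \<Omega>. \<forall>w\<in>Xsp \<Omega>. \<forall>v\<in>Xsp \<Omega>. bform \<Omega> a w v \<le> M * gnorm \<Omega> a * gnorm \<Omega> w * gnorm \<Omega> v"
    and w: "w \<in> Vsp \<Omega>" and v: "v \<in> Xsp \<Omega>"
  shows "bform \<Omega> w v v = 0"
proof -
  have wX: "w \<in> Xsp \<Omega>" using w by (simp add: Vsp_def)
  obtain \<phi> where \<phi>: "\<And>n. test_field \<Omega> (\<phi> n)"
    and lim: "(\<lambda>n. l2norm \<Omega> (\<lambda>x. \<phi> n x - v x) + l2norm \<Omega> (\<lambda>x. grad \<Omega> (\<phi> n) x - grad \<Omega> v x)) \<longlonglongrightarrow> 0"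
    using v unfolding Xsp_def by blast
  define \<delta> where "\<delta> n = (\<lambda>x. 1 *\<^sub>R \<phi> n x + (-1) *\<^sub>R v x)" for n
  have \<phi>X: "\<phi> n \<in> Xsp \<Omega>" for n by (intro test_field_in_Xsp op \<Omega> \<phi>)
  have \<delta>X: "\<delta> n \<in> Xsp \<Omega>" for n unfolding \<delta>_def by (intro Xsp_lincomb op \<Omega> \<phi>X v)
  have g: "gnorm \<Omega> (\<delta> n) = l2norm \<Omega> (\<lambda>x. grad \<Omega> (\<phi> n) x - grad \<Omega> v x)" for n
    unfolding \<delta>_def gnorm_lincomb[OF op \<Omega> \<phi>X v] by simp
  have g0: "(\<lambda>n. gnorm \<Omega> (\<delta> n)) \<longlonglongrightarrow> 0"
    unfolding g by (rule tendsto_sandwich[OF _ _ tendsto_const lim]) (auto simp: l2norm_nonneg)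
  have ab: "\<bar>bform \<Omega> w p q\<bar> \<le> M * gnorm \<Omega> w * gnorm \<Omega> p * gnorm \<Omega> q" if "p \<in> Xsp \<Omega>" "q \<in> Xsp \<Omega>" for p q
    by (rule abs_bform_le[OF dim op \<Omega> _ wX that]) (use bnd wX that in auto)
  let ?r = "\<lambda>n. M * gnorm \<Omega> w * gnorm \<Omega> v * gnorm \<Omega> (\<delta> n) + M * gnorm \<Omega> w * gnorm \<Omega> (\<delta> n) * gnorm \<Omega> v
      + M * gnorm \<Omega> w * gnorm \<Omega> (\<delta> n) * gnorm \<Omega> (\<delta> n)"
  have "\<bar>bform \<Omega> w v v\<bar> \<le> ?r n" for n
  proof -
    have \<phi>eq: "\<phi> n = (\<lambda>x. 1 *\<^sub>R v x + 1 *\<^sub>R \<delta> n x)" by (simp add: \<delta>_def)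
    have "0 = bform \<Omega> w (\<phi> n) (\<phi> n)" by (simp add: bform_test_field_zero[OF dim op \<Omega> w \<phi>])
    also have "\<dots> = bform \<Omega> w v (\<phi> n) + bform \<Omega> w (\<delta> n) (\<phi> n)"
      using bform_lincomb2[OF dim op \<Omega> wX v \<phi>X[of n] \<delta>X[of n], of 1 1] \<phi>eq by simp
    also have "bform \<Omega> w v (\<phi> n) = bform \<Omega> w v v + bform \<Omega> w v (\<delta> n)"
      using bform_lincomb3[OF dim op \<Omega> wX v v \<delta>X[of n], of 1 1] \<phi>eq by simp
    also have "bform \<Omega> w (\<delta> n) (\<phi> n) = bform \<Omega> w (\<delta> n) v + bform \<Omega> w (\<delta> n) (\<delta> n)"
      using bform_lincomb3[OF dim op \<Omega> wX \<delta>X[of n] v \<delta>X[of n], of 1 1] \<phi>eq by simp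
    finally show ?thesis
      using ab[OF v \<delta>X[of n]] ab[OF \<delta>X[of n] v] ab[OF \<delta>X[of n] \<delta>X[of n]] by linarith
  qed
  moreover have "?r \<longlonglongrightarrow> M * gnorm \<Omega> w * gnorm \<Omega> v * 0 + M * gnorm \<Omega> w * 0 * gnorm \<Omega> v + M * gnorm \<Omega> w * 0 * 0"
    by (intro tendsto_intros g0)
  ultimately have "\<bar>bform \<Omega> w v v\<bar> \<le> 0"
    using LIMSEQ_le_const[of ?r 0 "\<bar>bform \<Omega> w v v\<bar>"] by auto
  then show ?thesis by simp
qed

section \<open>Energy estimates\<close>


text \<open>Testing with \<open>u\<close> itself removes convection and gives f(u) = \<nu> |grad
  u|^2. The first alternative collects the cases in which \<open>u\<close> says nothing about the
  supremum: it is outside the index set, or its quotient is 0 by the convention on division by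
  zero.\<close>

lemma gnorm_NSE_sol_le:
  fixes u :: "real^'d \<Rightarrow> real^'d"
  assumes dim: "CARD('d) = 2 \<or> CARD('d) = 3" and op: "open \<Omega>" and \<Omega>: "\<Omega> \<in> lmeasurable"
    and bnd: "\<forall>a\<in>Xsp \<Omega>. \<forall>w\<in>Xsp \<Omega>. \<forall>v\<in>Xsp \<Omega>. bform \<Omega> a w v \<le> M * gnorm \<Omega> a * gnorm \<Omega> w * gnorm \<Omega> v"
    and f: "dual_V \<Omega> f" and u: "NSE_sol \<Omega> \<nu> f u" and \<nu>: "\<nu> > 0"
  shows "gnorm \<Omega> u = 0 \<or> \<nu> * gnorm \<Omega> u \<le> dual_norm \<Omega> f"
proof -
  have uV: "u \<in> Vsp \<Omega>" and uX: "u \<in> Xsp \<Omega>" using u by (auto simp: NSE_sol_def Vsp_def)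
  have "\<nu> * (gnorm \<Omega> u)\<^sup>2 + bform \<Omega> u u u = f u"
    using u uV by (simp add: NSE_sol_def aform_def gnorm_def l2norm_square)
  then have fu: "f u = \<nu> * (gnorm \<Omega> u)\<^sup>2"
    using bform_self_zero[OF dim op \<Omega> bnd uV uX] by simp
  show ?thesis
  proof (cases "u = (\<lambda>_. 0)")
    case True
    have "f (\<lambda>x. 0 *\<^sub>R u x + 0 *\<^sub>R u x) = 0 * f u + 0 * f u" using f uV unfolding dual_V_def by blast
    then have "f u = 0" using True by simp
    then show ?thesis using fu \<nu> by simp
  next
    case False
    show ?thesis
    proof (cases "gnorm \<Omega> u = 0")
      case nz: False
      obtain K where K: "\<forall>v\<in>Vsp \<Omega>. \<bar>f v\<bar> \<le> K * gnorm \<Omega> v" using f by (auto simp: dual_V_def)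
      \<comment> \<open>A real supremum dominates its members only when the set is bounded above.
        The maximum with 0 covers quotients with denominator 0, which are 0 by convention.\<close>
      have "f v / gnorm \<Omega> v \<le> max K 0" if "v \<in> Vsp \<Omega>" for v
      proof (cases "gnorm \<Omega> v = 0")
        case False
        then have "gnorm \<Omega> v > 0" using gnorm_nonneg[of \<Omega> v] by linarith
        moreover have "f v \<le> K * gnorm \<Omega> v" using K that by fastforce
        ultimately have "f v / gnorm \<Omega> v \<le> K" by (simp add: pos_divide_le_eq)
        then show ?thesis by simp
      qed simp
      then have "bdd_above ((\<lambda>v. f v / gnorm \<Omega> v) ` {v \<in> Vsp \<Omega>. v \<noteq> (\<lambda>_. 0)})" by (intro bdd_aboveI2) auto
      then have "f u / gnorm \<Omega> u \<le> dual_norm \<Omega> f"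
        unfolding dual_norm_def using uV False by (intro cSUP_upper) auto
      then show ?thesis using nz by (simp add: fu power2_eq_square)
    qed simp
  qed
qed

section \<open>The difference of the two solutions\<close>

lemma Vsp_diff:
  assumes op: "open \<Omega>" and \<Omega>: "\<Omega> \<in> lmeasurable" and w: "w \<in> Vsp \<Omega>" and u: "u \<in> Vsp \<Omega>"
  shows "(\<lambda>x. w x - u x) \<in> Vsp \<Omega>"
proof -
  have X: "w \<in> Xsp \<Omega>" "u \<in> Xsp \<Omega>" using w u by (auto simp: Vsp_def)
  have "AE x in lebesgue. x \<in> \<Omega> \<longrightarrow> trace (grad \<Omega> w x) = 0"
    "AE x in lebesgue. x \<in> \<Omega> \<longrightarrow> trace (grad \<Omega> u x) = 0"
    "AE x in lebesgue. x \<in> \<Omega> \<longrightarrow> grad \<Omega> (\<lambda>x. w x - u x) x = grad \<Omega> w x - grad \<Omega> u x"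
    using w u grad_lincomb(2)[OF op \<Omega> X[THEN Xsp_H1], of 1 "-1"] by (auto simp: Vsp_def ae_eq_on_def)
  then have "AE x in lebesgue. x \<in> \<Omega> \<longrightarrow> trace (grad \<Omega> (\<lambda>x. w x - u x) x) = 0"
    by eventually_elim (simp add: trace_def sum_subtractf)
  then show ?thesis using Xsp_lincomb[OF op \<Omega> X, of 1 "-1"] by (simp add: Vsp_def)
qed

text \<open>The convective difference is split so that the unknown \<open>w\<close> only transports
  \<open>e\<close>, where it cancels. What is left carries the gradient of \<open>u\<close>, which
  the energy estimate controls.\<close>

lemma CDA_difference_energy:
  fixes u w :: "real^'d \<Rightarrow> real^'d"
  assumes dim: "CARD('d) = 2 \<or> CARD('d) = 3" and op: "open \<Omega>" and \<Omega>: "\<Omega> \<in> lmeasurable"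
    and bnd: "\<forall>a\<in>Xsp \<Omega>. \<forall>w\<in>Xsp \<Omega>. \<forall>v\<in>Xsp \<Omega>. bform \<Omega> a w v \<le> M * gnorm \<Omega> a * gnorm \<Omega> w * gnorm \<Omega> v"
    and u: "NSE_sol \<Omega> \<nu> f u" and w: "CDA_sol \<Omega> \<nu> f \<mu> IH u w"
    and IH_L2: "\<forall>v\<in>Xsp \<Omega>. L2 \<Omega> (IH v)"
    and IH_lin: "\<forall>v\<in>Xsp \<Omega>. \<forall>w\<in>Xsp \<Omega>. \<forall>a b.
              ae_eq_on \<Omega> (IH (\<lambda>x. a *\<^sub>R v x + b *\<^sub>R w x)) (\<lambda>x. a *\<^sub>R IH v x + b *\<^sub>R IH w x)"
  defines "e \<equiv> \<lambda>x. w x - u x"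
  shows "\<nu> * (gnorm \<Omega> e)\<^sup>2 + \<mu> * (l2norm \<Omega> (IH e))\<^sup>2 = - bform \<Omega> e u e"
proof -
  have s: "\<Omega> \<in> sets lebesgue" using \<Omega> by auto
  have V: "w \<in> Vsp \<Omega>" "u \<in> Vsp \<Omega>" using u w by (auto simp: NSE_sol_def CDA_sol_def)
  have X: "w \<in> Xsp \<Omega>" "u \<in> Xsp \<Omega>" using V by (auto simp: Vsp_def)
  have eV: "e \<in> Vsp \<Omega>" unfolding e_def by (rule Vsp_diff[OF op \<Omega> V])
  have eX: "e \<in> Xsp \<Omega>" using eV by (simp add: Vsp_def)
  have e1: "e = (\<lambda>x. 1 *\<^sub>R w x + (-1) *\<^sub>R u x)" by (simp add: e_def)
  have w1: "w = (\<lambda>x. 1 *\<^sub>R u x + 1 *\<^sub>R e x)" by (simp add: e_def)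
  note Lg = Xsp_grad_L2[OF X(1)] Xsp_grad_L2[OF X(2)] Xsp_grad_L2[OF eX]
  have a: "aform \<Omega> \<nu> w e - aform \<Omega> \<nu> u e = \<nu> * (gnorm \<Omega> e)\<^sup>2"
  proof -
    have "AE x in lebesgue_on \<Omega>. grad \<Omega> e x = 1 *\<^sub>R grad \<Omega> w x + (-1) *\<^sub>R grad \<Omega> u x"
      using grad_lincomb(2)[OF op \<Omega> X[THEN Xsp_H1], of 1 "-1"] unfolding e1 ae_eq_on_iff[OF s] .
    then have ae: "AE x in lebesgue_on \<Omega>. grad \<Omega> w x \<bullet> grad \<Omega> e x - grad \<Omega> u x \<bullet> grad \<Omega> e x = grad \<Omega> e x \<bullet> grad \<Omega> e x"
      by eventually_elim (simp add: inner_diff_left)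
    note int = L2_inner_integrable[OF s Lg(1,3)] L2_inner_integrable[OF s Lg(2,3)] L2_inner_integrable[OF s Lg(3,3)]
    have "(LINT x|lebesgue_on \<Omega>. grad \<Omega> w x \<bullet> grad \<Omega> e x - grad \<Omega> u x \<bullet> grad \<Omega> e x)
        = (LINT x|lebesgue_on \<Omega>. grad \<Omega> e x \<bullet> grad \<Omega> e x)"
      using int by (intro integral_cong_AE ae borel_measurable_diff) auto
    then have "l2inner \<Omega> (grad \<Omega> w) (grad \<Omega> e) - l2inner \<Omega> (grad \<Omega> u) (grad \<Omega> e) = l2inner \<Omega> (grad \<Omega> e) (grad \<Omega> e)"
      using int by (simp add: l2inner_eq[OF s])
    then show ?thesis by (simp add: aform_def gnorm_def l2norm_square right_diff_distrib[symmetric])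
  qed
  have b: "bform \<Omega> w w e - bform \<Omega> u u e = bform \<Omega> e u e"
  proof -
    have "bform \<Omega> w w e = bform \<Omega> w u e + bform \<Omega> w e e"
      using bform_lincomb2[OF dim op \<Omega> X(1) X(2) eX eX, of 1 1] unfolding w1[symmetric] by simp
    moreover have "bform \<Omega> w e e = 0" by (rule bform_self_zero[OF dim op \<Omega> bnd V(1) eX])
    moreover have "bform \<Omega> w u e = bform \<Omega> u u e + bform \<Omega> e u e"
      using bform_lincomb1[OF dim op \<Omega> X(2) X(2) eX eX, of 1 1] unfolding w1[symmetric] by simp
    ultimately show ?thesis by simp
  qed
  have c: "l2inner \<Omega> (\<lambda>x. IH w x - IH u x) (IH e) = (l2norm \<Omega> (IH e))\<^sup>2"
  proof -
    have "ae_eq_on \<Omega> (IH e) (\<lambda>x. 1 *\<^sub>R IH w x + (-1) *\<^sub>R IH u x)"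
      unfolding e1 using IH_lin X by blast
    then have ae: "AE x in lebesgue_on \<Omega>. (IH w x - IH u x) \<bullet> IH e x = IH e x \<bullet> IH e x"
      unfolding ae_eq_on_iff[OF s] by eventually_elim simp
    have L: "L2 \<Omega> (IH e)" "L2 \<Omega> (\<lambda>x. IH w x - IH u x)"
      using IH_L2 eX X by (auto intro: L2_diff[OF s])
    show ?thesis unfolding l2norm_square unfolding l2inner_eq[OF s]
      using L2_inner_integrable[OF s L(2,1)] L2_inner_integrable[OF s L(1,1)]
      by (intro integral_cong_AE ae) auto
  qed
  have "aform \<Omega> \<nu> w e + bform \<Omega> w w e + \<mu> * l2inner \<Omega> (\<lambda>x. IH w x - IH u x) (IH e) = f e"
    using w eV by (simp add: CDA_sol_def)
  moreover have "aform \<Omega> \<nu> u e + bform \<Omega> u u e = f e" using u eV by (simp add: NSE_sol_def)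
  ultimately show ?thesis using a b c by simp
qed

text \<open>In the application \<open>g\<close>, \<open>m\<close>, \<open>l\<close> are |grad e|,
  |I_H e|, |e|, while \<open>L\<close> is C_I H and \<open>K\<close> is M_1 |grad u|. Nudging
  supplies control of \<open>l\<close> at the price of a quarter of the viscosity, and Young's
  inequality spends exactly that amount of \<open>l\<close> on the convection.\<close>

lemma CDA_small_H_absorption:
  fixes l g m K L \<nu> \<mu> :: real
  assumes pos: "\<nu> > 0" "L > 0" "l \<ge> 0" "g \<ge> 0" "m \<ge> 0"
    and energy: "\<nu> * g\<^sup>2 + \<mu> * m\<^sup>2 \<le> K * sqrt l * sqrt g * g"
    and K: "L * K\<^sup>2 \<le> \<nu>\<^sup>2 / 2"
    and \<mu>: "\<mu> \<ge> \<nu> / (4 * L\<^sup>2)"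
    and l: "l \<le> L * g + m"
  shows "g = 0" "m = 0"
proof -
  have \<mu>0: "\<mu> > 0" using \<mu> pos by (smt (verit) divide_pos_pos mult_pos_pos zero_less_power)
  have "l\<^sup>2 \<le> (L * g + m)\<^sup>2" using l pos by (intro power_mono) auto
  also have "\<dots> \<le> 2 * (L * g)\<^sup>2 + 2 * m\<^sup>2" using sum_squares_bound[of "L * g" m] by (simp add: power2_sum)
  finally have m: "m\<^sup>2 \<ge> l\<^sup>2 / 2 - L\<^sup>2 * g\<^sup>2" by (simp add: power_mult_distrib)
  \<comment> \<open>At the threshold value of \<mu> the loss \<open>L\<^sup>2 * g\<^sup>2\<close>
    costs a quarter of the viscous term.\<close>
  have "\<nu> / (4 * L\<^sup>2) * m\<^sup>2 \<le> \<mu> * m\<^sup>2" using \<mu> by (intro mult_right_mono) auto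
  moreover have "\<nu> / (4 * L\<^sup>2) * (l\<^sup>2 / 2 - L\<^sup>2 * g\<^sup>2) \<le> \<nu> / (4 * L\<^sup>2) * m\<^sup>2"
    using m pos by (intro mult_left_mono) auto
  moreover have "\<nu> / (4 * L\<^sup>2) * (l\<^sup>2 / 2 - L\<^sup>2 * g\<^sup>2) = \<nu> * l\<^sup>2 / (8 * L\<^sup>2) - \<nu> * g\<^sup>2 / 4"
    using pos by (simp add: field_simps)
  ultimately have lower: "\<nu> * l\<^sup>2 / (8 * L\<^sup>2) - \<nu> * g\<^sup>2 / 4 \<le> \<mu> * m\<^sup>2" by linarith
  let ?T = "K * sqrt l * sqrt g"
  have T2: "?T\<^sup>2 = K\<^sup>2 * (l * g)" using pos by (simp add: power_mult_distrib)
  have "2 * (t * g) \<le> t\<^sup>2 / \<nu> + \<nu> * g\<^sup>2" for t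
  proof -
    have "0 \<le> (t - \<nu> * g)\<^sup>2 / \<nu>" using pos by simp
    also have "\<dots> = t\<^sup>2 / \<nu> + \<nu> * g\<^sup>2 - 2 * (t * g)"
      using pos by (simp add: power2_diff field_simps power2_eq_square)
    finally show ?thesis by simp
  qed
  from this[of ?T] have T: "2 * (?T * g) \<le> K\<^sup>2 * (l * g) / \<nu> + \<nu> * g\<^sup>2" unfolding T2 .
  have "K\<^sup>2 * (l * g) \<le> (\<nu>\<^sup>2 / (2 * L)) * (l * g)"
    using K pos by (intro mult_right_mono) (auto simp: field_simps)
  \<comment> \<open>A second Young inequality, weighted by \<open>L\<close> so that
    \<open>l\<^sup>2\<close> reappears with the coefficient found in \<open>lower\<close>.\<close>
  also have "\<dots> \<le> (\<nu>\<^sup>2 / (2 * L)) * ((L * g\<^sup>2 + l\<^sup>2 / L) / 2)"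
  proof (intro mult_left_mono)
    have "0 \<le> (l - L * g)\<^sup>2 / L" using pos by simp
    also have "\<dots> = L * g\<^sup>2 + l\<^sup>2 / L - 2 * (l * g)"
      using pos by (simp add: power2_diff field_simps power2_eq_square)
    finally show "l * g \<le> (L * g\<^sup>2 + l\<^sup>2 / L) / 2" by simp
  qed (use pos in auto)
  also have "\<dots> = \<nu> * (\<nu> * g\<^sup>2 / 4 + \<nu> * l\<^sup>2 / (4 * L\<^sup>2))"
    using pos by (simp add: field_simps power2_eq_square)
  finally have "K\<^sup>2 * (l * g) / \<nu> \<le> \<nu> * g\<^sup>2 / 4 + \<nu> * l\<^sup>2 / (4 * L\<^sup>2)"
    using pos by (simp add: pos_divide_le_eq mult.commute)
  also have "\<nu> * l\<^sup>2 / (4 * L\<^sup>2) = 2 * (\<nu> * l\<^sup>2 / (8 * L\<^sup>2))" by simp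
  finally have "K\<^sup>2 * (l * g) / \<nu> \<le> \<nu> * g\<^sup>2 / 4 + 2 * (\<nu> * l\<^sup>2 / (8 * L\<^sup>2))" .
  with T have "?T * g \<le> 5 / 8 * (\<nu> * g\<^sup>2) + \<nu> * l\<^sup>2 / (8 * L\<^sup>2)" by linarith
  \<comment> \<open>The terms in \<open>l\<close> cancel, leaving 3/4 of
    \<open>\<nu> * g\<^sup>2\<close> on the left against 5/8 on the right.\<close>
  with energy lower have "\<nu> * g\<^sup>2 \<le> 0" by linarith
  then show g: "g = 0" using pos by (simp add: mult_le_0_iff)
  then have "\<mu> * m\<^sup>2 \<le> 0" using energy by simp
  then show "m = 0" using \<mu>0 by (simp add: mult_le_0_iff)
qed

theorem theorem1:
  fixes \<Omega> :: "(real^'d) set"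
    and \<nu> M M1 H CI C \<mu> :: real
    and f :: "(real^'d \<Rightarrow> real^'d) \<Rightarrow> real"
    and u :: "real^'d \<Rightarrow> real^'d"
    and IH :: "(real^'d \<Rightarrow> real^'d) \<Rightarrow> (real^'d \<Rightarrow> real^'d)"
  assumes dim: "CARD('d) = 2 \<or> CARD('d) = 3"
    and dom: "open \<Omega>" "bounded \<Omega>" "connected \<Omega>" "\<Omega> \<noteq> {}"
    and nu: "\<nu> > 0"
    and f: "dual_V \<Omega> f"
    and u: "NSE_sol \<Omega> \<nu> f u"
    and M: "M > 0" "\<forall>a\<in>Xsp \<Omega>. \<forall>w\<in>Xsp \<Omega>. \<forall>v\<in>Xsp \<Omega>.
              bform \<Omega> a w v \<le> M * gnorm \<Omega> a * gnorm \<Omega> w * gnorm \<Omega> v"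
    and M1: "M1 > 0" "\<forall>a\<in>Xsp \<Omega>. \<forall>w\<in>Xsp \<Omega>. \<forall>v\<in>Xsp \<Omega>.
              bform \<Omega> a w v \<le> M1 * sqrt (l2norm \<Omega> a) * sqrt (gnorm \<Omega> a) * gnorm \<Omega> w * gnorm \<Omega> v"
    and H: "H > 0"
    and IH_L2: "\<forall>v\<in>Xsp \<Omega>. L2 \<Omega> (IH v)"
    and IH_lin: "\<forall>v\<in>Xsp \<Omega>. \<forall>w\<in>Xsp \<Omega>. \<forall>a b.
              ae_eq_on \<Omega> (IH (\<lambda>x. a *\<^sub>R v x + b *\<^sub>R w x)) (\<lambda>x. a *\<^sub>R IH v x + b *\<^sub>R IH w x)"
    and CI: "CI > 0" "\<forall>v\<in>Xsp \<Omega>. l2norm \<Omega> (\<lambda>x. IH v x - v x) \<le> CI * H * gnorm \<Omega> v"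
    and C: "C > 0" "\<forall>v\<in>Xsp \<Omega>. l2norm \<Omega> (IH v) \<le> C * l2norm \<Omega> v"
    and mu: "\<mu> > 0"
  shows "(M * \<nu> powr (-2) * dual_norm \<Omega> f < 1 \<longrightarrow>
            CDA_sol \<Omega> \<nu> f \<mu> IH u u \<and> (\<forall>w. CDA_sol \<Omega> \<nu> f \<mu> IH u w \<longrightarrow> ae_eq_on \<Omega> w u))
       \<and> (M * \<nu> powr (-2) * dual_norm \<Omega> f \<ge> 1
            \<and> H \<le> 2 * M\<^sup>2 / (3 * sqrt 3 * CI * M1\<^sup>2 * (M * \<nu> powr (-2) * dual_norm \<Omega> f)\<^sup>2)
            \<and> \<mu> \<ge> \<nu> / (4 * CI\<^sup>2 * H\<^sup>2) \<longrightarrow>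
            CDA_sol \<Omega> \<nu> f \<mu> IH u u \<and> (\<forall>w. CDA_sol \<Omega> \<nu> f \<mu> IH u w \<longrightarrow> ae_eq_on \<Omega> w u))"
proof -
  note op = dom(1)
  have \<Omega>: "\<Omega> \<in> lmeasurable" using dom by (simp add: lmeasurable_open)
  then have s: "\<Omega> \<in> sets lebesgue" by auto
  let ?F = "dual_norm \<Omega> f" and ?G = "gnorm \<Omega> u"
  define \<alpha> where "\<alpha> = M * \<nu> powr (-2) * ?F"
  have \<alpha>: "\<alpha> * \<nu>\<^sup>2 = M * ?F" using nu by (simp add: \<alpha>_def powr_minus powr_numeral)
  have uX: "u \<in> Xsp \<Omega>" using u by (simp add: NSE_sol_def Vsp_def)
  have G: "?G = 0 \<or> \<nu> * ?G \<le> ?F" by (rule gnorm_NSE_sol_le[OF dim op \<Omega> M(2) f u nu])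
  \<comment> \<open>For w = u the nudging integrand is identically 0.\<close>
  have sol: "CDA_sol \<Omega> \<nu> f \<mu> IH u u"
    using u by (simp add: NSE_sol_def CDA_sol_def l2inner_def)
  have uniq: "ae_eq_on \<Omega> w u"
    if w: "CDA_sol \<Omega> \<nu> f \<mu> IH u w" and
      hyp: "\<alpha> < 1 \<or> \<alpha> \<ge> 1 \<and> H \<le> 2 * M\<^sup>2 / (3 * sqrt 3 * CI * M1\<^sup>2 * \<alpha>\<^sup>2) \<and> \<mu> \<ge> \<nu> / (4 * CI\<^sup>2 * H\<^sup>2)" for w
  proof -
    define e where "e = (\<lambda>x. w x - u x)"
    have wV: "w \<in> Vsp \<Omega>" and uV: "u \<in> Vsp \<Omega>" using w u by (auto simp: CDA_sol_def NSE_sol_def)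
    have eX: "e \<in> Xsp \<Omega>" using Vsp_diff[OF op \<Omega> wV uV] by (simp add: e_def Vsp_def)
    let ?g = "gnorm \<Omega> e" and ?l = "l2norm \<Omega> e" and ?m = "l2norm \<Omega> (IH e)"
    have nn: "?g \<ge> 0" "?l \<ge> 0" "?m \<ge> 0" "?G \<ge> 0" by (simp_all add: gnorm_nonneg l2norm_nonneg)
    have energy: "\<nu> * ?g\<^sup>2 + \<mu> * ?m\<^sup>2 = - bform \<Omega> e u e"
      unfolding e_def by (rule CDA_difference_energy[OF dim op \<Omega> M(2) u w IH_L2 IH_lin])
    have IHe: "L2 \<Omega> (IH e)" and Le: "L2 \<Omega> e" using IH_L2 eX Xsp_L2 by auto
    have l: "?l \<le> CI * H * ?g + ?m"
    proof -
      have "?l \<le> \<bar>-1\<bar> * l2norm \<Omega> (\<lambda>x. IH e x - e x) + \<bar>1\<bar> * ?m"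
        using l2norm_lincomb_le[OF s L2_diff[OF s IHe Le] IHe, of "-1" 1] by simp
      then show ?thesis using CI(2) eX by fastforce
    qed
    have "?g = 0 \<and> ?m = 0" using hyp
    proof
      assume a1: "\<alpha> < 1"
      have "- bform \<Omega> e u e \<le> M * ?g * ?G * ?g"
        using abs_bform_le[OF dim op \<Omega> _ eX uX eX, of "M * ?g * ?G"] M(2) eX uX by fastforce
      \<comment> \<open>The maximum with 0 covers the alternative
        \<open>gnorm \<Omega> u = 0\<close>, in which \<open>G\<close> gives no lower bound on
        \<open>\<alpha>\<close>.\<close>
      moreover have "M * ?G \<le> \<nu> * max 0 \<alpha>"
        using G
      proof
        assume "\<nu> * ?G \<le> ?F"
        then have "M * (\<nu> * ?G) \<le> \<nu> * (\<nu> * \<alpha>)" using M(1) \<alpha> by (simp add: power2_eq_square mult_ac)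
        then have "\<nu> * (M * ?G) \<le> \<nu> * (\<nu> * \<alpha>)" by (simp add: mult_ac)
        then have "M * ?G \<le> \<nu> * \<alpha>" using nu by simp
        also have "\<dots> \<le> \<nu> * max 0 \<alpha>" using nu by (intro mult_left_mono) auto
        finally show ?thesis .
      qed (use nu in simp)
      then have "(M * ?G) * ?g\<^sup>2 \<le> (\<nu> * max 0 \<alpha>) * ?g\<^sup>2" by (intro mult_right_mono) auto
      ultimately have "\<nu> * (1 - max 0 \<alpha>) * ?g\<^sup>2 + \<mu> * ?m\<^sup>2 \<le> 0"
        using energy by (simp add: algebra_simps power2_eq_square)
      moreover have "0 < \<nu> * (1 - max 0 \<alpha>)" using a1 nu by simp
      moreover from this have "0 \<le> \<nu> * (1 - max 0 \<alpha>) * ?g\<^sup>2" "0 \<le> \<mu> * ?m\<^sup>2" using mu by simp_all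
      ultimately have "\<nu> * (1 - max 0 \<alpha>) * ?g\<^sup>2 = 0" "\<mu> * ?m\<^sup>2 = 0" by linarith+
      then show ?thesis using \<open>0 < \<nu> * (1 - max 0 \<alpha>)\<close> mu nu a1 by auto
    next
      assume a2: "\<alpha> \<ge> 1 \<and> H \<le> 2 * M\<^sup>2 / (3 * sqrt 3 * CI * M1\<^sup>2 * \<alpha>\<^sup>2) \<and> \<mu> \<ge> \<nu> / (4 * CI\<^sup>2 * H\<^sup>2)"
      let ?L = "CI * H" and ?K = "M1 * ?G"
      \<comment> \<open>Since \<open>\<alpha>\<close> is at least 1 the dual norm is positive, so
        the alternative \<open>gnorm \<Omega> u = 0\<close> also yields
        \<open>\<nu> * ?G \<le> ?F\<close>.\<close>
      have "0 < M * ?F" using a2 nu by (simp add: \<alpha>[symmetric])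
      then have "\<nu> * ?G \<le> ?F" using G M(1) by (auto simp: zero_less_mult_iff)
      then have "M * (\<nu> * ?G) \<le> \<nu> * (\<nu> * \<alpha>)" using M(1) \<alpha> by (simp add: power2_eq_square mult_ac)
      then have "\<nu> * (M * ?G) \<le> \<nu> * (\<nu> * \<alpha>)" by (simp add: mult_ac)
      then have MG: "M * ?G \<le> \<nu> * \<alpha>" using nu by simp
      \<comment> \<open>This replaces 3 sqrt 3 by 4 in the bound on H and produces the 1/2 that the
        absorption lemma asks for.\<close>
      have "4 / 3 \<le> sqrt (3::real)" by (rule real_le_rsqrt) (simp add: power2_eq_square)
      then have "H \<le> 2 * M\<^sup>2 / (4 * (CI * M1\<^sup>2 * \<alpha>\<^sup>2))"
        using a2 CI(1) M1(1) M(1)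
        by (intro order_trans[OF conjunct1[OF conjunct2[OF a2]]] divide_left_mono)
          (auto simp: mult.assoc intro!: mult_right_mono)
      then have HL: "?L * M1\<^sup>2 * \<alpha>\<^sup>2 \<le> M\<^sup>2 / 2"
        using a2 CI(1) M1(1) by (simp add: field_simps)
      \<comment> \<open>Multiplying by \<open>M\<^sup>2\<close> lets \<open>MG\<close> replace the
        gradient of \<open>u\<close> by \<open>\<alpha>\<close>; \<open>HL\<close> then removes
        \<open>\<alpha>\<close> and returns the factor \<open>M\<^sup>2\<close>.\<close>
      have "M\<^sup>2 * (?L * ?K\<^sup>2) = ?L * M1\<^sup>2 * (M * ?G)\<^sup>2" by (simp add: power_mult_distrib mult_ac)
      also have "\<dots> \<le> ?L * M1\<^sup>2 * (\<nu> * \<alpha>)\<^sup>2"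
        using MG nn M(1) CI(1) H by (intro mult_left_mono power_mono) auto
      also have "\<dots> = \<nu>\<^sup>2 * (?L * M1\<^sup>2 * \<alpha>\<^sup>2)" by (simp add: power_mult_distrib mult_ac)
      also have "\<dots> \<le> \<nu>\<^sup>2 * (M\<^sup>2 / 2)" by (intro mult_left_mono HL) auto
      finally have "M\<^sup>2 * (?L * ?K\<^sup>2) \<le> M\<^sup>2 * (\<nu>\<^sup>2 / 2)" by (simp add: mult_ac)
      then have K: "?L * ?K\<^sup>2 \<le> \<nu>\<^sup>2 / 2" using M(1) by simp
      have "- bform \<Omega> e u e \<le> (M1 * sqrt ?l * sqrt ?g * ?G) * ?g"
        using abs_bform_le[OF dim op \<Omega> _ eX uX eX, of "M1 * sqrt ?l * sqrt ?g * ?G"] M1(2) eX uX by fastforce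
      then have "\<nu> * ?g\<^sup>2 + \<mu> * ?m\<^sup>2 \<le> ?K * sqrt ?l * sqrt ?g * ?g" using energy by (simp add: mult_ac)
      from CDA_small_H_absorption[OF nu _ nn(2,1,3) this K _ l]
      show ?thesis using CI(1) H a2 by (simp add: power_mult_distrib mult.assoc)
    qed
    then have "?l = 0" using l nn(2) by simp
    then have "AE x in lebesgue_on \<Omega>. e x = 0" by (rule ae_zero_if_l2norm_zero[OF s Le])
    then show "ae_eq_on \<Omega> w u" unfolding ae_eq_on_iff[OF s] by eventually_elim (simp add: e_def)
  qed
  show ?thesis using sol uniq unfolding \<alpha>_def by blast
qed

end
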